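(* Let $\kappa\ge2$, $\alpha>0$ and $\eta>1$, and consider the two walks $W^1,W^2$ on the complete graph $K_\kappa$ with occupation process $X$ described in the context (the case $\epsilon=0$). Let $$\mathcal K=\big\{(p^1,p^2)\in\mathcal D:\ \mathrm{supp}(p^1)\cap\mathrm{supp}(p^2)=\varnothing\big\},\qquad \mathfrak L(X)=\bigcap_{n\ge0}\overline{\bigcup_{k\ge n}\{X(k)\}} .$$ Then $\mathbb P(\mathfrak L(X)\subset\mathcal K)=1$.
   Context: Let $V=\{1,\dots,\kappa\}$ be the vertex set of $K_\kappa$, $\triangle$ the simplex of probability vectors on $V$, $\mathcal D=\triangle\times\triangle$, with points $x=(x^1,x^2)$, $x^i=(x_v^i)_{v\in V}$; $\mathrm{supp}(x^i)=\{v\in V:x_v^i>0\}$. For $i\in\{1,2\}$, $j=3-i$, $v\in V$ set $$\pi_v^i(x)=\frac{x_v^i(\eta-x_v^j)^\alpha}{\sum_{w\in V}x_w^i(\eta-x_w^j)^\alpha}.$$ The walks $W^i(n)\in V$, $n\ge1$, $i=1,2$, satisfy: with $X_v^i(0)=1/\kappa$, $X_v^i(n)=\frac1{\kappa+n}\big(1+\sum_{k=1}^n\mathbf 1\{W^i(k)=v\}\big)$, $X(n)=(X^1(n),X^2(n))\in\mathcal D$ and $\mathcal F_n=\sigma(W^i(k):i=1,2,\,1\le k\le n)$ ($\mathcal F_0$ trivial), $\mathbb P(W^i(n+1)=v\mid\mathcal F_n)=\pi_v^i(X(n))$ for all $n\ge0$, and $W^1(n+1),W^2(n+1)$ are conditionally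 independent given $\mathcal F_n$. *)

theory Defs
  imports "HOL-Probability.Probability"
begin

text \<open>
  The vertex set of the complete graph is a finite type \<open>'v\<close> with \<open>\<kappa> = CARD('v)\<close>. The two walks are
  indexed by the two-element type \<open>2\<close>, in which the numeral \<open>2\<close> denotes \<open>0\<close>. For \<open>i :: 2\<close>,
  the index of the other walk is again \<open>3 - i\<close>:
\<close>

lemma other_walk: "3 - (1 :: 2) = 2" "3 - (2 :: 2) = 1" "(1 :: 2) \<noteq> 2"
  by simp_all

definition prob_simplex :: "(real ^ 'v::finite) set" where
  "prob_simplex = {p. (\<forall>v. 0 \<le> p $ v) \<and> (\<Sum>v\<in>UNIV. p $ v) = 1}"

definition prob_pairs :: "(real ^ 'v::finite ^ 2) set" where
  "prob_pairs = {x. \<forall>i. x $ i \<in> prob_simplex}"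

definition supp :: "real ^ 'v::finite \<Rightarrow> 'v set" where
  "supp p = {v. p $ v > 0}"

definition disjoint_supp_pairs :: "(real ^ 'v::finite ^ 2) set" where
  "disjoint_supp_pairs = {p \<in> prob_pairs. supp (p $ 1) \<inter> supp (p $ 2) = {}}"

definition step_prob :: "real \<Rightarrow> real \<Rightarrow> 2 \<Rightarrow> 'v::finite \<Rightarrow> real ^ 'v ^ 2 \<Rightarrow> real" where
  "step_prob \<alpha> \<eta> i v x =
     x $ i $ v * (\<eta> - x $ (3 - i) $ v) powr \<alpha> /
     (\<Sum>w\<in>UNIV. x $ i $ w * (\<eta> - x $ (3 - i) $ w) powr \<alpha>)"

text \<open>
  Walks are functions \<open>W i n \<omega>\<close> of which only the values at times \<open>n \<ge> 1\<close> are used. For \<open>n = 0\<close>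
  the sum below is empty, and every coordinate equals \<open>1 / \<kappa>\<close>.
\<close>

definition occupation :: "(2 \<Rightarrow> nat \<Rightarrow> 'a \<Rightarrow> 'v::finite) \<Rightarrow> nat \<Rightarrow> 'a \<Rightarrow> real ^ 'v ^ 2" where
  "occupation W n \<omega> =
     (\<chi> i v. 1 / (real CARD('v) + real n) * (1 + (\<Sum>k = 1..n. of_bool (W i k \<omega> = v))))"

definition walk_history ::
    "'a measure \<Rightarrow> (2 \<Rightarrow> nat \<Rightarrow> 'a \<Rightarrow> 'v::finite) \<Rightarrow> nat \<Rightarrow> 'a measure" where
  "walk_history M W n =
     sigma (space M) {W i k -` A \<inter> space M | i k A. 1 \<le> k \<and> k \<le> n}"

definition cond_prob_given :: "'a measure \<Rightarrow> 'a measure \<Rightarrow> ('a \<Rightarrow> bool) \<Rightarrow> 'a \<Rightarrow> real" where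
  "cond_prob_given M F P = real_cond_exp M F (indicator {\<omega> \<in> space M. P \<omega>})"

definition cond_indep_var ::
    "'a measure \<Rightarrow> 'a measure \<Rightarrow> 'b measure \<Rightarrow> ('a \<Rightarrow> 'b) \<Rightarrow> 'c measure \<Rightarrow> ('a \<Rightarrow> 'c) \<Rightarrow> bool" where
  "cond_indep_var M F N\<^sub>1 Y\<^sub>1 N\<^sub>2 Y\<^sub>2 \<longleftrightarrow>
     (\<forall>A \<in> sets N\<^sub>1. \<forall>B \<in> sets N\<^sub>2. AE \<omega> in M.
        cond_prob_given M F (\<lambda>\<omega>. Y\<^sub>1 \<omega> \<in> A \<and> Y\<^sub>2 \<omega> \<in> B) \<omega> =
        cond_prob_given M F (\<lambda>\<omega>. Y\<^sub>1 \<omega> \<in> A) \<omega> * cond_prob_given M F (\<lambda>\<omega>. Y\<^sub>2 \<omega> \<in> B) \<omega>)"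

locale interacting_walks = prob_space M
  for M :: "'a measure" +
  fixes \<alpha> \<eta> :: real
    and W :: "2 \<Rightarrow> nat \<Rightarrow> 'a \<Rightarrow> 'v::finite"
  assumes random_variable_walk:
      "\<And>i n. n \<ge> 1 \<Longrightarrow> random_variable (count_space UNIV) (W i n)"
    and step_law:
      "\<And>n i v. AE \<omega> in M.
         cond_prob_given M (walk_history M W n) (\<lambda>\<omega>. W i (n + 1) \<omega> = v) \<omega> =
         step_prob \<alpha> \<eta> i v (occupation W n \<omega>)"
    and cond_indep_step:
      "\<And>n. cond_indep_var M (walk_history M W n)
         (count_space UNIV) (W 1 (n + 1)) (count_space UNIV) (W 2 (n + 1))"

definition limit_set :: "(nat \<Rightarrow> 'b::topological_space) \<Rightarrow> 'b set" where
  "limit_set X = (\<Inter>n. closure (\<Union>k\<in>{n..}. {X k}))"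

end

(*
  The overlap sum_v x^1_v x^2_v is a Lyapunov function of the mean-field dynamics: its drift is -gap 1 - gap 2,
  and by Chebyshev's sum identity gap i is a weighted sum of products of differences of x^j and of the
  decreasing function (eta - x^j)^alpha, hence nonnegative. The noise contributes O(1/n^2) to its mean,
  so the sum of E gap(X n) / n is finite and gap(X n) -> 0 almost surely. The gap vanishes only on
  the set K and at the finitely many points x^1 = x^2 = uniform distribution on a nonempty set S. Since these points are
  isolated and the steps shrink, it remains to exclude convergence to each of them.

  If S is a proper subset, a coordinate q = x^1_w with w outside S has drift at least c q / n. If S is the whole
  vertex set, q = |x^1 - x^2|^2 has drift at least c q / n + a / n^2, where the second term is the variance
  of the conditionally independent steps. In both cases ln(b / n + q) - E / (K + n q) is a
  submartingale near the point. It is bounded above, so by Fatou's lemma it cannot tend to minus infinity, whereas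
  q -> 0 would force that.
*)
theory Submission
  imports Defs
begin

section \<open>A logarithmic barrier for repelled processes\<close>

text \<open>The shift \<open>b / D\<close> is forced by the case of the full vertex set: there q
  vanishes at time 0 and may vanish again, so ln q alone would be minus infinity. The decay of the
  shift costs at most b / D^2 per step, and a drift surplus of that order must repay it. At the full
  vertex set the surplus is the noise; at a proper subset it is split off from the drift itself,
  because every coordinate is at least 1 / D. One criterion, \<open>escape\<close>, therefore serves
  both cases. In the scale y = D q the drift of the logarithm and its second-order loss both have
  order 1 / D. Linear growth wins when y is large, the bounded correction when y is bounded.
  Summability of E gap(X n) / n by itself gives only liminf 0 along almost every path. Convergence
  uses that the path moves little while n grows by a small factor.\<close>

text \<open>The bounded correction \<open>E / (K + D q)\<close> pays for the range \<open>q = O(1/D)\<close>, where the variance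
  of a step, of order \<open>q / D\<^sup>2\<close>, may give the logarithm alone a negative drift.
  The quantity \<open>D\<close> stands for \<open>\<kappa> + n\<close>.\<close>

definition barrier :: "real \<Rightarrow> real \<Rightarrow> real \<Rightarrow> real \<Rightarrow> real \<Rightarrow> real" where
  "barrier b K E D q = ln (b / D + q) - E / (K + D * q)"

text \<open>A lower bound for the increment that is affine in the first two moments \<open>m\<^sub>1\<close>, \<open>m\<^sub>2\<close> of the increment
  of \<open>q\<close>, so that it survives averaging.\<close>

definition barrier_gain :: "real \<Rightarrow> real \<Rightarrow> real \<Rightarrow> real \<Rightarrow> real \<Rightarrow> real \<Rightarrow> real \<Rightarrow> real" where
  "barrier_gain b K E D q m\<^sub>1 m\<^sub>2 =
     (let s = b / D + q; e = b / (D * (D + 1)); Z = K + D * q in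
       (m\<^sub>1 - e) / s - (4 * m\<^sub>2 + 4 * e\<^sup>2) / s\<^sup>2
       + E * (((D + 1) * m\<^sub>1 + q) / Z\<^sup>2 - (4 * (D + 1)\<^sup>2 * m\<^sub>2 + 4 * q\<^sup>2) / Z ^ 3))"

text \<open>Beyond \<open>t = 1/2\<close> the left side is negative and the logarithm positive, so
  upward jumps need no bound. This matters because one step may multiply a tiny \<open>q\<close> by
  a large factor.\<close>

lemma ln_one_plus_lower:
  fixes t :: real
  assumes "t \<ge> -1/2" shows "t - 2 * t\<^sup>2 \<le> ln (1 + t)"
proof (cases "t \<le> 1/2")
  case True
  then have "\<bar>t\<bar> \<le> 1/2" using assms by linarith
  from abs_ln_one_plus_x_minus_x_bound[OF this] show ?thesis by (simp add: abs_le_iff)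
next
  case False
  then have "t * (1 - 2 * t) \<le> 0" by (intro mult_nonneg_nonpos) auto
  moreover have "0 \<le> ln (1 + t)" using False by (intro ln_ge_zero) auto
  ultimately show ?thesis by (simp add: algebra_simps power2_eq_square)
qed

lemma square_diff_le: "(x - y)\<^sup>2 \<le> 2 * x\<^sup>2 + 2 * y\<^sup>2" for x y :: real
  using sum_squares_ge_zero[of "x + y" 0] by (simp add: power2_eq_square algebra_simps)

text \<open>The remainder factors exactly, and its sign is that of \<open>Z + 2 * d\<close>; again
  only downward steps have to be controlled.\<close>

lemma neg_inverse_increment:
  fixes Z d :: real
  assumes "Z > 0" "d \<ge> - Z / 2"
  shows "d / Z\<^sup>2 - 2 * d\<^sup>2 / Z ^ 3 \<le> 1 / Z - 1 / (Z + d)"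
proof -
  have Zd: "Z + d > 0" using assms by simp
  have "1 / Z - 1 / (Z + d) - (d / Z\<^sup>2 - 2 * d\<^sup>2 / Z ^ 3) = d\<^sup>2 * (Z + 2 * d) / (Z ^ 3 * (Z + d))"
    using assms Zd unfolding power2_eq_square power3_eq_cube by (simp add: divide_simps) algebra
  also have "\<dots> \<ge> 0"
    using assms Zd by (intro divide_nonneg_nonneg mult_nonneg_nonneg) auto
  finally show ?thesis by simp
qed

text \<open>At most half of \<open>b / D + q\<close> is lost in a step: a quarter through
  \<open>\<Delta>\<close> and a quarter through the decay of \<open>b / D\<close>, which is where
  \<open>D \<ge> 3\<close> enters. Since \<open>b \<le> K\<close>, the same bound limits the
  relative loss of \<open>K + D * q\<close>, and both one-sided expansions apply.\<close>

lemma barrier_increment: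
  assumes D: "D \<ge> 3" and b: "b > 0" "b \<le> K" and E: "E \<ge> 0" and q: "q \<ge> 0"
    and \<Delta>: "\<Delta> \<ge> - (q + b / D) / 4"
  shows "barrier_gain b K E D q \<Delta> (\<Delta>\<^sup>2) \<le> barrier b K E (D + 1) (q + \<Delta>) - barrier b K E D q"
proof -
  define s where "s = b / D + q"
  define e where "e = b / (D * (D + 1))"
  define Z where "Z = K + D * q"
  define d where "d = (D + 1) * \<Delta> + q"
  have bD: "b / D > 0" using D b by simp
  have s: "s > 0" using bD q by (simp add: s_def)
  have e0: "e \<ge> 0" using D b by (simp add: e_def)
  have "e = (b / D) / (D + 1)" by (simp add: e_def)
  also have "\<dots> \<le> (b / D) / 4" using D bD by (intro divide_left_mono) auto
  also have "\<dots> \<le> s / 4" using q by (simp add: s_def)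
  finally have e: "e \<le> s / 4" .
  have \<Delta>s: "\<Delta> \<ge> - s / 4" using \<Delta> by (simp add: s_def add.commute)
  have "b / (D + 1) = b / D - e" using D by (simp add: e_def divide_simps) algebra
  then have s': "b / (D + 1) + (q + \<Delta>) = s * (1 + (\<Delta> - e) / s)"
    using s by (simp add: distrib_left s_def)
  have t: "(\<Delta> - e) / s \<ge> - 1/2" using \<Delta>s e s by (simp add: field_simps)
  have Z: "Z > 0" using b D q by (simp add: Z_def add_pos_nonneg)
  have "d \<ge> - ((D + 1) * (s / 4))"
    using mult_left_mono[OF \<Delta>s, of "D + 1"] D q unfolding d_def mult_minus_left mult_minus_right by linarith
  moreover have "(D + 1) * (s / 4) \<le> D * s / 2"
    using D s mult_right_mono[of 1 D s] by (simp add: algebra_simps)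
  moreover have "D * s \<le> Z" using D b by (simp add: s_def Z_def distrib_left)
  ultimately have d: "d \<ge> - Z / 2" by linarith
  have Zd: "K + (D + 1) * (q + \<Delta>) = Z + d" by (simp add: Z_def d_def algebra_simps)
  have "ln (b / (D + 1) + (q + \<Delta>)) - ln s = ln (1 + (\<Delta> - e) / s)"
    unfolding s' using s t by (subst ln_mult) auto
  also have "\<dots> \<ge> (\<Delta> - e) / s - 2 * ((\<Delta> - e) / s)\<^sup>2" by (rule ln_one_plus_lower[OF t])
  finally have "(\<Delta> - e) / s - 2 * ((\<Delta> - e) / s)\<^sup>2 \<le> ln (b / (D + 1) + (q + \<Delta>)) - ln s" .
  moreover have "2 * ((\<Delta> - e) / s)\<^sup>2 \<le> (4 * \<Delta>\<^sup>2 + 4 * e\<^sup>2) / s\<^sup>2"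
    using divide_right_mono[of "2 * (\<Delta> - e)\<^sup>2" "4 * \<Delta>\<^sup>2 + 4 * e\<^sup>2" "s\<^sup>2"] square_diff_le[of \<Delta> e]
    by (simp add: power_divide)
  ultimately have 1: "(\<Delta> - e) / s - (4 * \<Delta>\<^sup>2 + 4 * e\<^sup>2) / s\<^sup>2 \<le> ln (b / (D + 1) + (q + \<Delta>)) - ln s"
    by simp
  have "2 * d\<^sup>2 \<le> 4 * (D + 1)\<^sup>2 * \<Delta>\<^sup>2 + 4 * q\<^sup>2"
    using square_diff_le[of "(D + 1) * \<Delta>" "-q"] by (simp add: d_def power_mult_distrib)
  then have "2 * d\<^sup>2 / Z ^ 3 \<le> (4 * (D + 1)\<^sup>2 * \<Delta>\<^sup>2 + 4 * q\<^sup>2) / Z ^ 3"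
    using Z by (intro divide_right_mono) auto
  then have "d / Z\<^sup>2 - (4 * (D + 1)\<^sup>2 * \<Delta>\<^sup>2 + 4 * q\<^sup>2) / Z ^ 3 \<le> 1 / Z - 1 / (Z + d)"
    using neg_inverse_increment[OF Z d] by linarith
  from mult_left_mono[OF this E]
  have "E * (d / Z\<^sup>2 - (4 * (D + 1)\<^sup>2 * \<Delta>\<^sup>2 + 4 * q\<^sup>2) / Z ^ 3) \<le> E / Z - E / (Z + d)"
    by (simp add: right_diff_distrib)
  with 1 show ?thesis
    unfolding barrier_def barrier_gain_def Let_def Zd
    by (simp add: s_def[symmetric] e_def[symmetric] Z_def[symmetric] d_def[symmetric])
qed

text \<open>With \<open>y = D * q\<close> every contribution is 1 / D times a function of
  \<open>y\<close>. \<open>K\<close> is large enough for the second-order loss of the correction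
  term to be covered by its own drift, and \<open>E\<close> is large enough for the net gain to
  cover the loss of the logarithm at bounded \<open>y\<close>.\<close>

lemma barrier_gain_nonneg:
  assumes pos: "b > 0" "c > 0" "C \<ge> 0" "Q \<ge> 0"
  defines "K \<equiv> 16 * C + 4 * Q + b + 1"
  defines "E \<equiv> 4 * C * (K + 4 * C / c)\<^sup>2 / b\<^sup>2"
  assumes D: "D \<ge> 1" "D \<ge> 1 / b" "D \<ge> (4 * C + 4 * b\<^sup>2) / b\<^sup>2"
    and q: "0 \<le> q" "q \<le> Q"
    and m1: "m\<^sub>1 \<ge> (c * q + 2 * b / D) / D" and m2: "m\<^sub>2 \<le> C * (q + 1 / D\<^sup>2) / D\<^sup>2"
  shows "barrier_gain b K E D q m\<^sub>1 m\<^sub>2 \<ge> 0"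
proof -
  define y where "y = D * q"
  have D0: "D > 0" using D by simp
  have y: "y \<ge> 0" and qy: "q = y / D" using q D0 by (simp_all add: y_def)
  define s where "s = b / D + q"
  define e where "e = b / (D * (D + 1))"
  define Z where "Z = K + y"
  have K: "K \<ge> 1" "K \<ge> 16 * C + 4 * Q" using pos by (simp_all add: K_def)
  have Z: "Z \<ge> 1" "Z \<ge> 16 * C + 4 * Q" using K y by (simp_all add: Z_def)
  have E: "E \<ge> 0" using pos by (simp add: E_def)
  have by0: "b + y > 0" using pos y by simp
  have s: "s = (b + y) / D" using D0 by (simp add: s_def qy add_divide_distrib)
  have s0: "s > 0" using by0 D0 by (simp add: s)
  have e: "0 \<le> e" "e \<le> b / D\<^sup>2"
    using pos D0 by (simp_all add: e_def power2_eq_square frac_le)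
  \<comment> \<open>Half of the surplus 2 b / D^2 pays for the decay \<open>e\<close> of the shift;
    the other half remains as the \<open>b\<close> in the numerator.\<close>
  have A1: "(m\<^sub>1 - e) / s \<ge> ((c * y + b) / (b + y)) / D"
  proof -
    have "(c * q + 2 * b / D) / D - b / D\<^sup>2 = (c * y + b) / D\<^sup>2"
      using D0 by (simp add: qy field_simps power2_eq_square)
    then have "((c * y + b) / (b + y)) / D = ((c * q + 2 * b / D) / D - b / D\<^sup>2) / s"
      using D0 by (simp add: s power2_eq_square)
    also have "\<dots> \<le> (m\<^sub>1 - e) / s" using m1 e s0 by (intro divide_right_mono) auto
    finally show ?thesis .
  qed
  \<comment> \<open>The 1 / D^2 part of \<open>m\<^sub>2\<close> and the square of \<open>e\<close>
    are of lower order. The third bound on \<open>D\<close> absorbs them into \<open>b * b\<close>,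
    and the resulting \<open>b / (b + y)\<close> is exactly what the surplus kept in
    \<open>A1\<close> cancels.\<close>
  have A2: "(4 * m\<^sub>2 + 4 * e\<^sup>2) / s\<^sup>2 \<le> ((4 * C * y) / (b + y)\<^sup>2 + b / (b + y)) / D"
  proof -
    have "e\<^sup>2 \<le> (b / D\<^sup>2)\<^sup>2" using e by (intro power_mono) auto
    with m2 have "(4 * m\<^sub>2 + 4 * e\<^sup>2) / s\<^sup>2 \<le> (4 * (C * (q + 1 / D\<^sup>2) / D\<^sup>2) + 4 * (b / D\<^sup>2)\<^sup>2) / s\<^sup>2"
      by (intro divide_right_mono add_mono mult_left_mono) auto
    also have "4 * (C * (q + 1 / D\<^sup>2) / D\<^sup>2) + 4 * (b / D\<^sup>2)\<^sup>2 = (4 * C * y + (4 * C + 4 * b\<^sup>2) / D) / D ^ 3"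
      using D0 by (simp add: qy field_simps power2_eq_square power3_eq_cube)
    also have "\<dots> / s\<^sup>2 = (4 * C * y + (4 * C + 4 * b\<^sup>2) / D) / (b + y)\<^sup>2 / D"
      unfolding s using D0 by (simp add: power2_eq_square power3_eq_cube)
    also have "\<dots> = ((4 * C * y) / (b + y)\<^sup>2 + ((4 * C + 4 * b\<^sup>2) / D) / (b + y)\<^sup>2) / D"
      by (simp only: add_divide_distrib)
    also have "(4 * C + 4 * b\<^sup>2) / D \<le> b * b" using D(3) D0 pos
      by (simp add: field_simps power2_eq_square)
    also have "b * b \<le> b * (b + y)" using pos y by simp
    also have "b * (b + y) / (b + y)\<^sup>2 = b / (b + y)" using by0 by (simp add: power2_eq_square)
    finally show ?thesis using D0 by0 by (simp add: divide_right_mono)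
  qed
  \<comment> \<open>The drift of \<open>D * q\<close> is at least (y + 2 b) / D, and
    \<open>K \<ge> 16 * C + 4 * Q\<close> keeps the quadratic loss below (y + b) / D after division
    by \<open>Z\<close>; the difference b / D is the net gain.\<close>
  have A3: "((D + 1) * m\<^sub>1 + q) / Z\<^sup>2 - (4 * (D + 1)\<^sup>2 * m\<^sub>2 + 4 * q\<^sup>2) / Z ^ 3 \<ge> (b / Z\<^sup>2) / D"
  proof -
    have m10: "(c * q + 2 * b / D) / D \<ge> 0" using pos q D0 by simp
    have "(c * y + 2 * b) / D = D * ((c * q + 2 * b / D) / D)" using D0 by (simp add: qy field_simps)
    also have "\<dots> \<le> (D + 1) * m\<^sub>1" using m1 m10 D0 by (intro mult_mono) auto
    finally have "(y + 2 * b) / D \<le> (D + 1) * m\<^sub>1 + q"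
      using pos y D0 by (simp add: qy add_divide_distrib) (smt (verit) divide_nonneg_pos mult_nonneg_nonneg)
    then have u: "((y + 2 * b) / D) / Z\<^sup>2 \<le> ((D + 1) * m\<^sub>1 + q) / Z\<^sup>2" by (intro divide_right_mono) auto
    have "(D + 1)\<^sup>2 \<le> (2 * D)\<^sup>2" using D by (intro power_mono) auto
    then have "(D + 1)\<^sup>2 * m\<^sub>2 \<le> (2 * D)\<^sup>2 * (C * (q + 1 / D\<^sup>2) / D\<^sup>2)"
      using m2 pos q D0 by (smt (verit) divide_nonneg_nonneg mult_left_mono mult_right_mono mult_nonneg_nonneg zero_le_power2)
    also have "\<dots> = 4 * C * (y + 1 / D) / D" using D0 by (simp add: qy field_simps power2_eq_square)
    finally have "4 * (D + 1)\<^sup>2 * m\<^sub>2 \<le> 16 * C * (y + 1 / D) / D" by simp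
    moreover have "q\<^sup>2 \<le> Q * (y / D)" using q unfolding qy[symmetric] power2_eq_square by (intro mult_right_mono)
    ultimately have "4 * (D + 1)\<^sup>2 * m\<^sub>2 + 4 * q\<^sup>2 \<le> (16 * C * (y + 1 / D) + 4 * Q * y) / D"
      by (simp add: add_divide_distrib)
    also have "\<dots> = ((16 * C + 4 * Q) * y + (16 * C) * (1 / D)) / D" by (simp add: algebra_simps)
    also have "\<dots> \<le> (Z * y + Z * b) / D"
    proof -
      have "1 / D \<le> b" using D pos D0 by (simp add: field_simps)
      then show ?thesis using Z y pos D0
        by (intro divide_right_mono add_mono mult_right_mono mult_mono) auto
    qed
    finally have "(4 * (D + 1)\<^sup>2 * m\<^sub>2 + 4 * q\<^sup>2) / Z ^ 3 \<le> ((Z * y + Z * b) / D) / Z ^ 3"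
      using Z by (intro divide_right_mono) auto
    also have "\<dots> = ((y + b) / D) / Z\<^sup>2"
      using Z D0 by (simp add: field_simps power2_eq_square power3_eq_cube)
    finally have l: "(4 * (D + 1)\<^sup>2 * m\<^sub>2 + 4 * q\<^sup>2) / Z ^ 3 \<le> ((y + b) / D) / Z\<^sup>2" .
    have "((y + 2 * b) / D) / Z\<^sup>2 = ((y + b) / D) / Z\<^sup>2 + (b / Z\<^sup>2) / D"
      unfolding mult_2 by (simp add: add_divide_distrib mult.commute)
    with u l show ?thesis by linarith
  qed
  \<comment> \<open>Once c y reaches 4 C the drift of the logarithm suffices. Otherwise
    \<open>Z\<close> is at most K + 4 C / c, and \<open>E\<close> is chosen to make
    \<open>E * b / Z\<^sup>2\<close> at least 4 C / b there.\<close>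
  have A4: "4 * C * y / (b + y)\<^sup>2 \<le> c * y / (b + y) + E * (b / Z\<^sup>2)"
  proof -
    have "4 * C * y / (b + y)\<^sup>2 = (4 * C / (b + y)) * (y / (b + y))" by (simp add: power2_eq_square)
    also have "\<dots> \<le> 4 * C / (b + y)" using pos y by (intro mult_left_le) auto
    finally have le: "4 * C * y / (b + y)\<^sup>2 \<le> 4 * C / (b + y)" .
    show ?thesis
    proof (cases "4 * C \<le> c * y")
      case True
      then have "4 * C / (b + y) \<le> c * y / (b + y)" using by0 by (simp add: divide_right_mono)
      moreover have "E * (b / Z\<^sup>2) \<ge> 0" using E pos by simp
      ultimately show ?thesis using le by linarith
    next
      case False
      then have "y \<le> 4 * C / c" using pos by (simp add: field_simps)
      then have "Z\<^sup>2 \<le> (K + 4 * C / c)\<^sup>2" using Z by (intro power_mono) (auto simp: Z_def)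
      moreover have "K + 4 * C / c > 0" using K pos by (simp add: add_pos_nonneg)
      ultimately have "E * (b / Z\<^sup>2) \<ge> E * (b / (K + 4 * C / c)\<^sup>2)"
        using E pos Z by (intro mult_left_mono divide_left_mono) auto
      also have "E * (b / (K + 4 * C / c)\<^sup>2) = 4 * C / b"
        using \<open>K + 4 * C / c > 0\<close> pos by (simp add: E_def power2_eq_square)
      finally have "4 * C / b \<le> E * (b / Z\<^sup>2)" .
      moreover have "4 * C / (b + y) \<le> 4 * C / b" using pos y by (intro divide_left_mono) auto
      moreover have "c * y / (b + y) \<ge> 0" using pos y by simp
      ultimately show ?thesis using le by linarith
    qed
  qed
  have "0 \<le> ((c * y + b) / (b + y) - ((4 * C * y) / (b + y)\<^sup>2 + b / (b + y)) + E * (b / Z\<^sup>2)) / D"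
    by (rule divide_nonneg_pos[OF _ D0]) (use A4 in \<open>simp add: add_divide_distrib\<close>)
  also have "\<dots> = ((c * y + b) / (b + y)) / D - ((4 * C * y) / (b + y)\<^sup>2 + b / (b + y)) / D + E * ((b / Z\<^sup>2) / D)"
    by (simp add: add_divide_distrib diff_divide_distrib)
  also have "\<dots> \<le> barrier_gain b K E D q m\<^sub>1 m\<^sub>2"
    using A1 A2 mult_left_mono[OF A3 E]
    unfolding barrier_gain_def Let_def s_def[symmetric] e_def[symmetric] y_def[symmetric] Z_def[symmetric]
    by linarith
  finally show ?thesis .
qed

section \<open>One step of the walks\<close>

definition move :: "real \<Rightarrow> real ^ 'v::finite ^ 2 \<Rightarrow> 'v \<Rightarrow> 'v \<Rightarrow> real ^ 'v ^ 2" where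
  "move D x v w = (\<chi> i u. (D * x $ i $ u + of_bool ((if i = 1 then v else w) = u)) / (D + 1))"

lemma move_nth [simp]:
  "move D x v w $ 1 $ u = (D * x $ 1 $ u + of_bool (v = u)) / (D + 1)"
  "move D x v w $ 2 $ u = (D * x $ 2 $ u + of_bool (w = u)) / (D + 1)"
  by (simp_all add: move_def)

text \<open>The conditional mean of \<open>h\<close> at the next pair of vertices, given the present
  state. The product of the two step laws encodes the conditional independence of the walks.\<close>

definition step_mean :: "real \<Rightarrow> real \<Rightarrow> real ^ 'v::finite ^ 2 \<Rightarrow> ('v \<Rightarrow> 'v \<Rightarrow> real) \<Rightarrow> real" where
  "step_mean \<alpha> \<eta> x h =
     (\<Sum>v\<in>UNIV. \<Sum>w\<in>UNIV. step_prob \<alpha> \<eta> 1 v x * step_prob \<alpha> \<eta> 2 w x * h v w)"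

lemma prob_pairs_nonneg: "x \<in> prob_pairs \<Longrightarrow> 0 \<le> x $ i $ v"
  by (simp add: prob_pairs_def prob_simplex_def)

lemma prob_pairs_sum: "x \<in> prob_pairs \<Longrightarrow> (\<Sum>v\<in>UNIV. x $ i $ v) = 1"
  by (simp add: prob_pairs_def prob_simplex_def)

lemma prob_pairs_le_1: "x \<in> prob_pairs \<Longrightarrow> x $ i $ v \<le> 1"
  using member_le_sum[of v UNIV "\<lambda>v. x $ i $ v"] prob_pairs_nonneg[of x i] prob_pairs_sum[of x i] by simp

lemma move_in_prob_pairs:
  assumes "x \<in> prob_pairs" "D \<ge> 0"
  shows "move D x v w \<in> prob_pairs"
  using assms prob_pairs_sum[OF assms(1), of 1] prob_pairs_sum[OF assms(1), of 2]
  by (auto simp: prob_pairs_def prob_simplex_def forall_2 add_nonneg_nonneg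
      sum_divide_distrib[symmetric] sum.distrib sum_distrib_left[symmetric])

locale repulsion =
  fixes \<alpha> \<eta> :: real
  assumes \<alpha>_pos: "\<alpha> > 0" and \<eta>_gt_1: "\<eta> > 1"
begin

definition weight :: "real \<Rightarrow> real" where
  "weight t = (\<eta> - t) powr \<alpha>"

definition total :: "2 \<Rightarrow> real ^ 'v::finite ^ 2 \<Rightarrow> real" where
  "total i x = (\<Sum>w\<in>UNIV. x $ i $ w * weight (x $ (3 - i) $ w))"

abbreviation "\<pi> \<equiv> step_prob \<alpha> \<eta>"
abbreviation "E \<equiv> step_mean \<alpha> \<eta>"

lemma weight_pos: "t \<le> 1 \<Longrightarrow> weight t > 0"
  using \<eta>_gt_1 by (simp add: weight_def)

lemma weight_strict_antimono: "s < t \<Longrightarrow> t \<le> 1 \<Longrightarrow> weight t < weight s"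
  using \<eta>_gt_1 \<alpha>_pos unfolding weight_def by (intro powr_less_mono2) auto

lemma weight_antimono: "s \<le> t \<Longrightarrow> t \<le> 1 \<Longrightarrow> weight t \<le> weight s"
  using weight_strict_antimono[of s t] by (cases "s = t") auto

lemma total_ge:
  assumes "x \<in> prob_pairs" shows "total i x \<ge> weight 1"
proof -
  have "weight 1 = (\<Sum>w\<in>UNIV. x $ i $ w * weight 1)"
    using prob_pairs_sum[OF assms, of i] by (simp add: sum_distrib_right[symmetric])
  also have "\<dots> \<le> total i x"
    unfolding total_def using assms
    by (intro sum_mono mult_left_mono weight_antimono) (auto simp: prob_pairs_le_1 prob_pairs_nonneg)
  finally show ?thesis .
qed

lemma total_pos: "x \<in> prob_pairs \<Longrightarrow> total i x > 0"
  using total_ge[of x i] weight_pos[of 1] by simp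

lemma step_prob_eq: "\<pi> i v x = x $ i $ v * weight (x $ (3 - i) $ v) / total i x"
  by (simp add: step_prob_def weight_def total_def)

lemma step_prob_nonneg: "x \<in> prob_pairs \<Longrightarrow> \<pi> i v x \<ge> 0"
  using total_pos[of x i] by (simp add: step_prob_eq prob_pairs_nonneg prob_pairs_le_1 weight_pos less_imp_le)

lemma step_prob_sum: "x \<in> prob_pairs \<Longrightarrow> (\<Sum>v\<in>UNIV. \<pi> i v x) = 1"
  using total_pos[of x i] by (simp add: step_prob_eq sum_divide_distrib[symmetric] total_def[symmetric])

lemma step_mean_fst: "x \<in> prob_pairs \<Longrightarrow> E x (\<lambda>v w. g v) = (\<Sum>v\<in>UNIV. \<pi> 1 v x * g v)"
  using step_prob_sum[of x 2]
  by (simp add: step_mean_def mult.commute[of _ "\<pi> 2 _ x"] sum_distrib_right[symmetric] mult.assoc)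

lemma step_mean_snd: "x \<in> prob_pairs \<Longrightarrow> E x (\<lambda>v w. g w) = (\<Sum>w\<in>UNIV. \<pi> 2 w x * g w)"
  using step_prob_sum[of x 1]
  by (simp add: step_mean_def sum_distrib_left[symmetric] sum_distrib_right[symmetric] mult.assoc)

lemma step_mean_const: "x \<in> prob_pairs \<Longrightarrow> E x (\<lambda>v w. c) = c"
  using step_prob_sum[of x 1] by (simp add: step_mean_fst sum_distrib_right[symmetric])

lemma step_mean_add: "E x (\<lambda>v w. g v w + h v w) = E x g + E x h"
  by (simp add: step_mean_def distrib_left sum.distrib)

lemma step_mean_diff: "E x (\<lambda>v w. g v w - h v w) = E x g - E x h"
  by (simp add: step_mean_def right_diff_distrib sum_subtractf)

lemma step_mean_mult: "E x (\<lambda>v w. c * g v w) = c * E x g"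
  by (simp add: step_mean_def sum_distrib_left mult_ac)

lemma step_mean_mono:
  "x \<in> prob_pairs \<Longrightarrow> (\<And>v w. g v w \<le> h v w) \<Longrightarrow> E x g \<le> E x h"
  unfolding step_mean_def by (intro sum_mono mult_left_mono) (auto simp: step_prob_nonneg)

lemma barrier_mean_increment:
  assumes x: "x \<in> prob_pairs" and D: "D \<ge> 3" and b: "b > 0" "b \<le> K" and c: "C\<^sub>0 \<ge> 0" and q: "q x \<ge> 0"
    and \<Delta>: "\<And>v w. q (move D x v w) - q x \<ge> - (q x + b / D) / 4"
  shows "barrier b K C\<^sub>0 D (q x) + barrier_gain b K C\<^sub>0 D (q x)
      (E x (\<lambda>v w. q (move D x v w) - q x)) (E x (\<lambda>v w. (q (move D x v w) - q x)\<^sup>2))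
    \<le> E x (\<lambda>v w. barrier b K C\<^sub>0 (D + 1) (q (move D x v w)))"
proof -
  have lin: "\<exists>A B C'. \<forall>m\<^sub>1 m\<^sub>2. barrier_gain b K C\<^sub>0 D (q x) m\<^sub>1 m\<^sub>2 = A + B * m\<^sub>1 + C' * m\<^sub>2"
  proof -
    define s where "s = b / D + q x"
    define e where "e = b / (D * (D + 1))"
    define Z where "Z = K + D * q x"
    have "barrier_gain b K C\<^sub>0 D (q x) m\<^sub>1 m\<^sub>2 =
      (- e / s - 4 * e\<^sup>2 / s\<^sup>2 + C\<^sub>0 * (q x / Z\<^sup>2 - 4 * (q x)\<^sup>2 / Z ^ 3))
      + (1 / s + C\<^sub>0 * (D + 1) / Z\<^sup>2) * m\<^sub>1
      + (- 4 / s\<^sup>2 - C\<^sub>0 * (4 * (D + 1)\<^sup>2) / Z ^ 3) * m\<^sub>2" for m\<^sub>1 m\<^sub>2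
      unfolding barrier_gain_def Let_def s_def[symmetric] e_def[symmetric] Z_def[symmetric]
      by (simp add: add_divide_distrib diff_divide_distrib algebra_simps)
    then show ?thesis by blast
  qed
  then obtain A B C' where
    lin: "\<And>m\<^sub>1 m\<^sub>2. barrier_gain b K C\<^sub>0 D (q x) m\<^sub>1 m\<^sub>2 = A + B * m\<^sub>1 + C' * m\<^sub>2" by blast
  let ?d = "\<lambda>v w. q (move D x v w) - q x"
  have "barrier b K C\<^sub>0 D (q x) + barrier_gain b K C\<^sub>0 D (q x) (E x ?d) (E x (\<lambda>v w. (?d v w)\<^sup>2))
    = E x (\<lambda>v w. barrier b K C\<^sub>0 D (q x) + barrier_gain b K C\<^sub>0 D (q x) (?d v w) ((?d v w)\<^sup>2))"
    unfolding lin by (simp only: step_mean_add step_mean_mult step_mean_const[OF x])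
  also have "\<dots> \<le> E x (\<lambda>v w. barrier b K C\<^sub>0 (D + 1) (q (move D x v w)))"
  proof (rule step_mean_mono[OF x])
    fix v w
    show "barrier b K C\<^sub>0 D (q x) + barrier_gain b K C\<^sub>0 D (q x) (?d v w) ((?d v w)\<^sup>2)
      \<le> barrier b K C\<^sub>0 (D + 1) (q (move D x v w))"
      using barrier_increment[OF D b c q \<Delta>, of v w] by simp
  qed
  finally show ?thesis .
qed

end

section \<open>The overlap as a Lyapunov function\<close>

text \<open>For empty \<open>S\<close> this is the zero pair, which lies outside
  \<open>prob_pairs\<close>; hence the conditions \<open>S \<noteq> {}\<close> below.\<close>

definition uniform_pair :: "'v set \<Rightarrow> real ^ 'v::finite ^ 2" where
  "uniform_pair S = (\<chi> i v. if v \<in> S then 1 / real (card S) else 0)"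

definition overlap :: "real ^ 'v::finite ^ 2 \<Rightarrow> real" where
  "overlap x = (\<Sum>v\<in>UNIV. x $ 1 $ v * x $ 2 $ v)"

text \<open>Both sides are minus twice the covariance of \<open>a\<close> and \<open>b\<close> under
  \<open>p\<close>. After symmetrization the sign can be read off term by term when \<open>a\<close>
  and \<open>b\<close> are oppositely ordered.\<close>

lemma covariance_double_sum:
  fixes p a b :: "'a::finite \<Rightarrow> real"
  assumes "sum p UNIV = 1"
  shows "(\<Sum>v\<in>UNIV. \<Sum>w\<in>UNIV. p v * p w * ((a v - a w) * (b w - b v))) =
    2 * ((\<Sum>v\<in>UNIV. p v * a v) * (\<Sum>v\<in>UNIV. p v * b v) - (\<Sum>v\<in>UNIV. p v * a v * b v))"
proof -
  have "p v * p w * ((a v - a w) * (b w - b v)) =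
      (p v * a v) * (p w * b w) + (p v * b v) * (p w * a w) - (p v * a v * b v) * p w - p v * (p w * a w * b w)" for v w
    by (simp add: algebra_simps)
  then have "(\<Sum>v\<in>UNIV. \<Sum>w\<in>UNIV. p v * p w * ((a v - a w) * (b w - b v))) =
      (\<Sum>v\<in>UNIV. p v * a v) * (\<Sum>w\<in>UNIV. p w * b w) + (\<Sum>v\<in>UNIV. p v * b v) * (\<Sum>w\<in>UNIV. p w * a w)
      - (\<Sum>v\<in>UNIV. p v * a v * b v) * sum p UNIV - sum p UNIV * (\<Sum>v\<in>UNIV. p v * a v * b v)"
    by (simp only: sum.distrib sum_subtractf sum_product)
  then show ?thesis using assms by (simp add: mult.commute)
qed

lemma compact_prob_pairs: "compact (prob_pairs :: (real ^ 'v::finite ^ 2) set)"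
proof -
  have "prob_pairs = (\<Inter>i. \<Inter>v. {x :: real ^ 'v ^ 2. 0 \<le> x $ i $ v}) \<inter> (\<Inter>i. {x. (\<Sum>v\<in>UNIV. x $ i $ v) = 1})"
    by (auto simp: prob_pairs_def prob_simplex_def)
  moreover have "closed \<dots>"
    by (intro closed_Int closed_INT ballI closed_Collect_le closed_Collect_eq continuous_intros)
  ultimately have "closed (prob_pairs :: (real ^ 'v ^ 2) set)" by simp
  moreover have "bounded (prob_pairs :: (real ^ 'v ^ 2) set)"
  proof (rule boundedI)
    fix x :: "real ^ 'v ^ 2" assume x: "x \<in> prob_pairs"
    have "norm x \<le> (\<Sum>i\<in>UNIV. norm (x $ i))" unfolding norm_vec_def by (rule L2_set_le_sum) simp
    also have "\<dots> \<le> (\<Sum>i\<in>(UNIV :: 2 set). 1)"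
    proof (rule sum_mono)
      fix i
      have "norm (x $ i) \<le> (\<Sum>v\<in>UNIV. \<bar>x $ i $ v\<bar>)" by (rule norm_le_l1_cart)
      then show "norm (x $ i) \<le> 1" using x by (simp add: prob_pairs_nonneg prob_pairs_sum)
    qed
    finally show "norm x \<le> 2" by simp
  qed
  ultimately show ?thesis by (simp add: compact_eq_bounded_closed)
qed

text \<open>Each component moves by (e_v - x^i) / (D + 1), a multiple of the difference of two
  probability vectors, whose l1 norm is at most 2.\<close>

lemma dist_move_le:
  assumes x: "x \<in> prob_pairs" and D: "D \<ge> 0"
  shows "dist (move D x v w) x \<le> 4 / (D + 1)"
proof -
  have D1: "D + 1 > 0" using D by simp
  have "norm (y $ i) \<le> 2 / (D + 1)" if "y = move D x v w - x" for y i
  proof -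
    have eq: "(D * t + a) / (D + 1) - t = (a - t) / (D + 1)" for t a
      using D1 by (simp add: field_simps)
    have "norm (y $ i) \<le> (\<Sum>u\<in>UNIV. \<bar>y $ i $ u\<bar>)" by (rule norm_le_l1_cart)
    also have "\<dots> \<le> (\<Sum>u\<in>UNIV. (of_bool ((if i = 1 then v else w) = u) + x $ i $ u) / (D + 1))"
    proof (rule sum_mono)
      fix u
      have "y $ i $ u = (of_bool ((if i = 1 then v else w) = u) - x $ i $ u) / (D + 1)"
        unfolding that by (simp add: move_def eq)
      moreover have "\<bar>of_bool P - x $ i $ u\<bar> \<le> of_bool P + x $ i $ u" for P
        using prob_pairs_nonneg[OF x, of i u] by (cases P) auto
      ultimately show "\<bar>y $ i $ u\<bar> \<le> (of_bool ((if i = 1 then v else w) = u) + x $ i $ u) / (D + 1)"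
        using D1 by (simp only: abs_divide) (simp add: divide_right_mono)
    qed
    also have "\<dots> = 2 / (D + 1)"
      using prob_pairs_sum[OF x, of i] by (simp add: sum_divide_distrib[symmetric] sum.distrib)
    finally show ?thesis .
  qed
  then have "(\<Sum>i\<in>UNIV. norm ((move D x v w - x) $ i)) \<le> (\<Sum>i\<in>(UNIV :: 2 set). 2 / (D + 1))"
    by (intro sum_mono) blast
  moreover have "norm (move D x v w - x) \<le> (\<Sum>i\<in>UNIV. norm ((move D x v w - x) $ i))"
    unfolding norm_vec_def by (rule L2_set_le_sum) simp
  ultimately show ?thesis by (simp add: dist_norm)
qed

lemma overlap_move:
  assumes "D \<ge> 0"
  shows "overlap (move D x v w) =
    (D\<^sup>2 * overlap x + D * x $ 1 $ w + D * x $ 2 $ v + of_bool (v = w)) / (D + 1)\<^sup>2"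
proof -
  have eq: "move D x v w $ 1 $ u * move D x v w $ 2 $ u =
      (D\<^sup>2 * (x $ 1 $ u * x $ 2 $ u) + D * (if u = w then x $ 1 $ u else 0) + D * (if u = v then x $ 2 $ u else 0)
        + (if u = v then of_bool (v = w) else 0)) / (D + 1)\<^sup>2" for u
    by (simp add: power2_eq_square algebra_simps)
  show ?thesis
    unfolding overlap_def eq
    by (simp add: sum_divide_distrib[symmetric] sum.distrib sum_distrib_left[symmetric])
qed

lemma overlap_nonneg: "x \<in> prob_pairs \<Longrightarrow> 0 \<le> overlap x"
  unfolding overlap_def by (intro sum_nonneg mult_nonneg_nonneg prob_pairs_nonneg)

lemma overlap_le_1:
  assumes x: "x \<in> prob_pairs" shows "overlap x \<le> 1"
proof -
  have "overlap x \<le> (\<Sum>v\<in>UNIV. x $ 1 $ v)"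
    unfolding overlap_def using x by (intro sum_mono) (simp add: mult_left_le prob_pairs_nonneg prob_pairs_le_1)
  then show ?thesis using prob_pairs_sum[OF x, of 1] by simp
qed

text \<open>A Tauberian argument: if \<open>d n \<ge> \<epsilon>\<close>, slow decrease keeps
  \<open>d\<close> above \<epsilon> / 2 on a block of about \<rho> n indices, whose weights add up
  to a fixed multiple of \<rho>. One such block far enough out violates the Cauchy
  criterion.\<close>

lemma tendsto_0_if_weighted_summable:
  fixes d w :: "nat \<Rightarrow> real"
  assumes d: "\<And>n. 0 \<le> d n" and c: "c > 0" "\<And>n. c / (real n + 1) \<le> w n"
    and sum: "summable (\<lambda>n. w n * d n)"
    and slow: "\<And>\<epsilon>. \<epsilon> > 0 \<Longrightarrow> \<exists>\<rho>>0. \<forall>n m. n \<le> m \<longrightarrow> real m - real n \<le> \<rho> * real n \<longrightarrow> d n - \<epsilon> \<le> d m"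
  shows "d \<longlonglongrightarrow> 0"
proof (rule LIMSEQ_I)
  fix \<epsilon> :: real assume \<epsilon>: "\<epsilon> > 0"
  obtain \<rho>\<^sub>0 where \<rho>\<^sub>0: "\<rho>\<^sub>0 > 0"
    "\<And>n m. n \<le> m \<Longrightarrow> real m - real n \<le> \<rho>\<^sub>0 * real n \<Longrightarrow> d n - \<epsilon> / 2 \<le> d m"
    using slow[of "\<epsilon> / 2"] \<epsilon> by auto
  \<comment> \<open>Capping at 1 keeps the block within indices up to 2 n, so that its weights are
    at least c / (3 n).\<close>
  define \<rho> where "\<rho> = min \<rho>\<^sub>0 1"
  have \<rho>: "\<rho> > 0" "\<rho> \<le> 1" "\<rho> \<le> \<rho>\<^sub>0" using \<rho>\<^sub>0 by (auto simp: \<rho>_def)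
  \<comment> \<open>The 6 combines the factor 3 from the weights with the factor 2 from \<epsilon> /
    2.\<close>
  have "c * \<epsilon> * \<rho> / 6 > 0" using c \<epsilon> \<rho> by simp
  then obtain N where N: "\<And>m n. m \<ge> N \<Longrightarrow> norm (sum (\<lambda>n. w n * d n) {m..<n}) < c * \<epsilon> * \<rho> / 6"
    using sum unfolding summable_Cauchy by blast
  have "norm (d n - 0) < \<epsilon>" if n: "n \<ge> max N 1" for n
  proof (rule ccontr)
    assume "\<not> norm (d n - 0) < \<epsilon>"
    then have dn: "d n \<ge> \<epsilon>" using d[of n] by simp
    \<comment> \<open>The block has \<open>k + 1\<close> indices, hence more than \<rho> n of them,
      even when the floor is 0.\<close>
    define k where "k = nat \<lfloor>\<rho> * real n\<rfloor>"
    have "0 \<le> \<rho> * real n" using \<rho> by simp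
    then have k: "real k \<le> \<rho> * real n" "\<rho> * real n < real k + 1"
      unfolding k_def by linarith+
    have "\<rho> * real n \<le> 1 * real n" using \<rho> by (intro mult_right_mono) auto
    moreover have \<rho>n: "\<rho> * real n \<le> \<rho>\<^sub>0 * real n" using \<rho> by (intro mult_right_mono) auto
    ultimately have kn: "real k \<le> real n" using k by linarith
    have bnd: "w j * d j \<ge> c * \<epsilon> / (6 * real n)" if j: "j \<in> {n..<n + k + 1}" for j
    proof -
      have "real j \<le> real n + real k" using j by simp
      then have jn: "real j - real n \<le> \<rho>\<^sub>0 * real n" "real j + 1 \<le> 3 * real n"
        using k kn n \<rho>n by linarith+
      have "d j \<ge> \<epsilon> / 2" using \<rho>\<^sub>0(2)[of n j] jn j dn by simp
      moreover have "c / (3 * real n) \<le> c / (real j + 1)" using jn c by (intro divide_left_mono) auto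
      then have "c / (3 * real n) \<le> w j" using c(2)[of j] by simp
      ultimately have "(c / (3 * real n)) * (\<epsilon> / 2) \<le> w j * d j"
        using c \<epsilon> by (intro mult_mono) (auto intro: order_trans[OF _ c(2)])
      then show ?thesis by simp
    qed
    have "c * \<epsilon> * \<rho> / 6 = (\<rho> * real n) * (c * \<epsilon> / (6 * real n))" using n by simp
    also have "\<dots> \<le> (real k + 1) * (c * \<epsilon> / (6 * real n))"
      using k c \<epsilon> by (intro mult_right_mono) auto
    also have "\<dots> = (\<Sum>j\<in>{n..<n + k + 1}. c * \<epsilon> / (6 * real n))" by simp
    also have "\<dots> \<le> (\<Sum>j\<in>{n..<n + k + 1}. w j * d j)" by (rule sum_mono) (rule bnd)
    also have "\<dots> < c * \<epsilon> * \<rho> / 6" using le_less_trans[OF abs_ge_self N[of n "n + k + 1", unfolded real_norm_def]] n by simp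
    finally show False by simp
  qed
  then show "\<exists>no. \<forall>n\<ge>no. norm (d n - 0) < \<epsilon>" by blast
qed

context repulsion
begin

text \<open>The mean-field velocity of walk \<open>i\<close> is
  \<open>\<pi> i v x - x $ i $ v\<close>; here it is paired, with reversed sign, with the occupation
  of the other walk.\<close>

definition gap :: "2 \<Rightarrow> real ^ 'v::finite ^ 2 \<Rightarrow> real" where
  "gap i x = (\<Sum>v\<in>UNIV. x $ (3 - i) $ v * (x $ i $ v - \<pi> i v x))"

text \<open>Multiplication by \<open>total i x\<close> clears the normalization of the step law.
  What remains is minus the covariance, under x^i, of x^j and \<open>weight\<close> of x^j.\<close>

lemma gap_eq:
  assumes x: "x \<in> prob_pairs"
  shows "2 * total i x * gap i x = (\<Sum>v\<in>UNIV. \<Sum>w\<in>UNIV. x $ i $ v * x $ i $ w *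
    ((x $ (3 - i) $ v - x $ (3 - i) $ w) * (weight (x $ (3 - i) $ w) - weight (x $ (3 - i) $ v))))"
proof -
  have t: "total i x \<noteq> 0" using total_pos[OF x, of i] by simp
  have "total i x * gap i x = (\<Sum>v\<in>UNIV. x $ i $ v * x $ (3 - i) $ v) * total i x
      - (\<Sum>v\<in>UNIV. x $ i $ v * x $ (3 - i) $ v * weight (x $ (3 - i) $ v))"
    unfolding gap_def sum_distrib_left sum_distrib_right sum_subtractf[symmetric]
    using t by (intro sum.cong) (auto simp: step_prob_eq field_simps)
  then show ?thesis
    using covariance_double_sum[OF prob_pairs_sum[OF x], of i "\<lambda>v. x $ (3 - i) $ v" "\<lambda>v. weight (x $ (3 - i) $ v)"]
    by (simp add: total_def)
qed

lemma gap_term_nonneg: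
  assumes x: "x \<in> prob_pairs"
  shows "0 \<le> x $ i $ v * x $ i $ w *
    ((x $ j $ v - x $ j $ w) * (weight (x $ j $ w) - weight (x $ j $ v)))"
proof -
  have "0 \<le> (x $ j $ v - x $ j $ w) * (weight (x $ j $ w) - weight (x $ j $ v))"
  proof (cases "x $ j $ v \<le> x $ j $ w")
    case True
    then show ?thesis
      using weight_antimono[OF True prob_pairs_le_1[OF x]] by (intro mult_nonpos_nonpos) auto
  next
    case False
    then show ?thesis
      using weight_antimono[of "x $ j $ w" "x $ j $ v"] prob_pairs_le_1[OF x] by (intro mult_nonneg_nonneg) auto
  qed
  then show ?thesis using x by (intro mult_nonneg_nonneg[OF mult_nonneg_nonneg] prob_pairs_nonneg)
qed

lemma gap_nonneg:
  assumes x: "x \<in> prob_pairs" shows "0 \<le> gap i x"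
proof -
  have "0 \<le> 2 * total i x * gap i x"
    unfolding gap_eq[OF x] by (intro sum_nonneg gap_term_nonneg x)
  then show ?thesis using total_pos[OF x, of i] by (simp add: zero_le_mult_iff)
qed

text \<open>A vanishing sum of nonnegative terms vanishes term by term, and \<open>weight\<close> is
  strictly decreasing.\<close>

lemma gap_zeroD:
  assumes x: "x \<in> prob_pairs" and gap: "gap i x = 0" and v: "x $ i $ v > 0" and w: "x $ i $ w > 0"
  shows "x $ (3 - i) $ v = x $ (3 - i) $ w"
proof (rule ccontr)
  let ?y = "x $ (3 - i)"
  assume ne: "?y $ v \<noteq> ?y $ w"
  let ?T = "\<lambda>v w. x $ i $ v * x $ i $ w * ((?y $ v - ?y $ w) * (weight (?y $ w) - weight (?y $ v)))"
  have nn: "0 \<le> ?T v w" for v w by (rule gap_term_nonneg[OF x])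
  have "?T v w \<le> (\<Sum>w\<in>UNIV. ?T v w)" by (rule member_le_sum) (rule nn UNIV_I finite)+
  also have "\<dots> \<le> (\<Sum>v\<in>UNIV. \<Sum>w\<in>UNIV. ?T v w)"
    by (rule member_le_sum[of v UNIV "\<lambda>v. \<Sum>w\<in>UNIV. ?T v w"]) (rule sum_nonneg nn UNIV_I finite)+
  also have "\<dots> = 0" unfolding gap_eq[OF x, symmetric] gap by simp
  finally have "?T v w = 0" using nn[of v w] by linarith
  then have "(?y $ v - ?y $ w) * (weight (?y $ w) - weight (?y $ v)) = 0" using v w by (metis mult_eq_0_iff less_irrefl)
  then have "weight (?y $ w) = weight (?y $ v)" using ne by simp
  then show False
    using ne weight_strict_antimono[of "?y $ v" "?y $ w"] weight_strict_antimono[of "?y $ w" "?y $ v"]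
      prob_pairs_le_1[OF x] by (metis less_irrefl linorder_neqE_linordered_idom)
qed

text \<open>If the supports meet at \<open>u\<close>, then x^2 is constant on the support of x^1
  with the positive value at \<open>u\<close>, so the first support lies in the second. By symmetry
  the supports coincide, and both vectors are constant on them.\<close>

lemma gap_zero_cases:
  assumes x: "x \<in> prob_pairs" and gap: "gap 1 x + gap 2 x = 0"
  shows "x \<in> disjoint_supp_pairs \<or> (\<exists>S. S \<noteq> {} \<and> x = uniform_pair S)"
proof (cases "supp (x $ 1) \<inter> supp (x $ 2) = {}")
  case True
  then show ?thesis using x by (simp add: disjoint_supp_pairs_def)
next
  case False
  then obtain u where u: "x $ 1 $ u > 0" "x $ 2 $ u > 0" by (auto simp: supp_def)
  have g: "gap 1 x = 0" "gap 2 x = 0" using gap gap_nonneg[OF x, of 1] gap_nonneg[OF x, of 2] by linarith+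
  have e2: "x $ 2 $ v = x $ 2 $ u" if "x $ 1 $ v > 0" for v
    using gap_zeroD[OF x g(1) that u(1)] by (simp add: other_walk)
  have e1: "x $ 1 $ v = x $ 1 $ u" if "x $ 2 $ v > 0" for v
    using gap_zeroD[OF x g(2) that u(2)] by (simp add: other_walk)
  define S where "S = supp (x $ 1)"
  have S2: "v \<in> S \<longleftrightarrow> x $ 2 $ v > 0" for v
    using e1[of v] e2[of v] u by (auto simp: S_def supp_def)
  have const: "x $ i $ v = (if v \<in> S then x $ i $ u else 0)" for i v
  proof -
    have "i = 1 \<or> i = 2" by (rule exhaust_2)
    then show ?thesis
      using e1[of v] e2[of v] S2[of v] prob_pairs_nonneg[OF x, of i v] by (auto simp: S_def supp_def)
  qed
  have "u \<in> S" using u by (simp add: S_def supp_def)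
  have "real (card S) * x $ i $ u = 1" for i
  proof -
    have "1 = (\<Sum>v\<in>UNIV. if v \<in> S then x $ i $ u else 0)"
      unfolding prob_pairs_sum[OF x, of i, symmetric] by (rule sum.cong[OF refl const])
    then show ?thesis by (simp add: sum.If_cases)
  qed
  then have "x $ i $ u = 1 / real (card S)" for i
    by (metis mult.commute nonzero_eq_divide_eq mult_zero_left zero_neq_one)
  then have "x $ i $ v = uniform_pair S $ i $ v" for i v using const[of i v] by (simp add: uniform_pair_def)
  then have "x = uniform_pair S" by (simp add: vec_eq_iff)
  then show ?thesis using \<open>u \<in> S\<close> by blast
qed

lemma continuous_on_weight: "continuous_on prob_pairs (\<lambda>x. weight (x $ i $ v))"
  unfolding weight_def
proof (intro continuous_intros)
  show "\<forall>x\<in>prob_pairs. \<eta> - x $ i $ v \<noteq> 0"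
    using \<eta>_gt_1 prob_pairs_le_1 by (metis diff_gt_0_iff_gt less_le_trans linorder_not_less order_less_irrefl)
qed

lemma continuous_on_total: "continuous_on prob_pairs (total i)"
  unfolding total_def by (intro continuous_intros continuous_on_weight)

lemma continuous_on_step_prob: "continuous_on prob_pairs (\<pi> i v)"
  unfolding step_prob_eq
  by (intro continuous_intros continuous_on_weight continuous_on_total ballI)
    (metis total_pos less_irrefl)

lemma continuous_on_gap: "continuous_on prob_pairs (gap i)"
  unfolding gap_def by (intro continuous_intros continuous_on_step_prob)

text \<open>The terms linear in the new vertices average exactly to the overlap minus the gaps. The
  coefficient (D^2 + 2 D) / (D + 1)^2 of the overlap is rounded up to 1, and the coincidence of the
  two new vertices costs at most 1 / (D + 1)^2.\<close>

lemma step_mean_overlap: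
  assumes x: "x \<in> prob_pairs" and D: "D \<ge> 0"
  shows "E x (\<lambda>v w. overlap (move D x v w)) \<le>
    overlap x - D / (D + 1)\<^sup>2 * (gap 1 x + gap 2 x) + 1 / (D + 1)\<^sup>2"
proof -
  have D1: "(D + 1)\<^sup>2 > 0" using D by simp
  have "overlap (move D x v w) \<le> D\<^sup>2 * overlap x / (D + 1)\<^sup>2 + (D / (D + 1)\<^sup>2 * x $ 1 $ w + D / (D + 1)\<^sup>2 * x $ 2 $ v)
      + 1 / (D + 1)\<^sup>2" for v w
    using D1 unfolding overlap_move[OF D] by (simp add: add_divide_distrib)
  then have "E x (\<lambda>v w. overlap (move D x v w)) \<le>
      E x (\<lambda>v w. D\<^sup>2 * overlap x / (D + 1)\<^sup>2 + (D / (D + 1)\<^sup>2 * x $ 1 $ w + D / (D + 1)\<^sup>2 * x $ 2 $ v) + 1 / (D + 1)\<^sup>2)"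
    by (intro step_mean_mono x)
  also have "\<dots> = D\<^sup>2 * overlap x / (D + 1)\<^sup>2 + (D / (D + 1)\<^sup>2 * (\<Sum>w\<in>UNIV. \<pi> 2 w x * x $ 1 $ w)
      + D / (D + 1)\<^sup>2 * (\<Sum>v\<in>UNIV. \<pi> 1 v x * x $ 2 $ v)) + 1 / (D + 1)\<^sup>2"
    by (simp only: step_mean_add step_mean_mult step_mean_const[OF x] step_mean_fst[OF x] step_mean_snd[OF x])
  also have "(\<Sum>w\<in>UNIV. \<pi> 2 w x * x $ 1 $ w) = overlap x - gap 2 x"
    by (simp add: overlap_def gap_def other_walk right_diff_distrib sum_subtractf mult.commute)
  also have "(\<Sum>v\<in>UNIV. \<pi> 1 v x * x $ 2 $ v) = overlap x - gap 1 x"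
    by (simp add: overlap_def gap_def other_walk right_diff_distrib sum_subtractf mult.commute)
  also have "D\<^sup>2 * overlap x / (D + 1)\<^sup>2 + (D / (D + 1)\<^sup>2 * (overlap x - gap 2 x) + D / (D + 1)\<^sup>2 * (overlap x - gap 1 x))
      + 1 / (D + 1)\<^sup>2 = (D\<^sup>2 + 2 * D) / (D + 1)\<^sup>2 * overlap x - D / (D + 1)\<^sup>2 * (gap 1 x + gap 2 x) + 1 / (D + 1)\<^sup>2"
    by (simp add: add_divide_distrib diff_divide_distrib algebra_simps)
  also have "(D\<^sup>2 + 2 * D) / (D + 1)\<^sup>2 * overlap x \<le> 1 * overlap x"
    using D1 by (intro mult_right_mono overlap_nonneg x) (simp add: power2_eq_square algebra_simps)
  finally show ?thesis by simp
qed

end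

section \<open>Linear instability of the uniform equilibria\<close>

lemma continuous_on_near:
  fixes g :: "'a::metric_space \<Rightarrow> real"
  assumes "continuous_on S g" "p \<in> S" "\<epsilon> > 0"
  obtains r where "r > 0" "\<And>x. x \<in> S \<Longrightarrow> dist x p < r \<Longrightarrow> \<bar>g x - g p\<bar> < \<epsilon>"
  using assms unfolding continuous_on_iff dist_real_def by metis

lemma uniform_pair_in_prob_pairs:
  assumes "S \<noteq> {}" shows "uniform_pair S \<in> (prob_pairs :: (real ^ 'v::finite ^ 2) set)"
proof -
  have "card S > 0" using assms by (simp add: card_gt_0_iff)
  then show ?thesis
    by (auto simp: prob_pairs_def prob_simplex_def uniform_pair_def sum.If_cases)
qed

context repulsion
begin

lemma total_uniform_pair:
  assumes "S \<noteq> {}"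
  shows "total i (uniform_pair S) = weight (1 / real (card (S :: 'v::finite set)))"
proof -
  have "card S > 0" using assms by (simp add: card_gt_0_iff)
  moreover have "total i (uniform_pair S) = (\<Sum>w\<in>UNIV. if w \<in> S then 1 / real (card S) * weight (1 / real (card S)) else 0)"
    unfolding total_def by (intro sum.cong) (auto simp: uniform_pair_def)
  ultimately show ?thesis using assms by (simp add: sum.If_cases)
qed

text \<open>Near the uniform distribution on a proper subset, a vertex outside of it is almost free of the
  other walk, hence more attractive than the average vertex.\<close>

lemma repelled_from_proper_subset:
  fixes S :: "'v::finite set"
  assumes S: "S \<noteq> {}" and w: "w \<notin> S"
  obtains c r where "c > 0" "r > 0"
    "\<And>x. x \<in> prob_pairs \<Longrightarrow> dist x (uniform_pair S) < r \<Longrightarrow> (1 + c) * x $ 1 $ w \<le> \<pi> 1 w x"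
proof -
  let ?p = "uniform_pair S"
  have p: "?p \<in> prob_pairs" by (rule uniform_pair_in_prob_pairs[OF S])
  define g where "g x = weight (x $ 2 $ w) / total 1 x" for x :: "real ^ 'v ^ 2"
  have cont: "continuous_on prob_pairs g"
    unfolding g_def by (intro continuous_intros continuous_on_weight continuous_on_total ballI)
      (metis total_pos less_irrefl)
  have card: "card S > 0" using S by (simp add: card_gt_0_iff)
  then have "weight (1 / real (card S)) < weight 0" by (intro weight_strict_antimono) auto
  moreover have "weight (1 / real (card S)) > 0" using card by (intro weight_pos) simp
  ultimately have "g ?p > 1"
    using w by (simp add: g_def total_uniform_pair[OF S]) (simp add: uniform_pair_def)
  then have pos: "(g ?p - 1) / 2 > 0" by simp
  obtain r where r: "r > 0" "\<And>x. x \<in> prob_pairs \<Longrightarrow> dist x ?p < r \<Longrightarrow> \<bar>g x - g ?p\<bar> < (g ?p - 1) / 2"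
    using continuous_on_near[OF cont p pos] by blast
  show thesis
  proof (rule that[OF pos r(1)])
    fix x :: "real ^ 'v ^ 2" assume x: "x \<in> prob_pairs" "dist x ?p < r"
    have "1 + (g ?p - 1) / 2 \<le> g x" using r(2)[OF x] unfolding abs_less_iff by (simp add: field_simps)
    then have "(1 + (g ?p - 1) / 2) * x $ 1 $ w \<le> g x * x $ 1 $ w"
      using x by (intro mult_right_mono prob_pairs_nonneg)
    also have "\<dots> = \<pi> 1 w x" by (simp add: step_prob_eq g_def other_walk)
    finally show "(1 + (g ?p - 1) / 2) * x $ 1 $ w \<le> \<pi> 1 w x" .
  qed
qed

lemma DERIV_weight:
  assumes "t \<le> 1"
  shows "(weight has_real_derivative - (\<alpha> * (\<eta> - t) powr (\<alpha> - 1))) (at t)"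
  unfolding weight_def using assms \<eta>_gt_1
  by (auto intro!: derivative_eq_intros)

text \<open>The mean value theorem without an order on \<open>s\<close> and \<open>t\<close>.
  Equality is allowed, so that an intermediate point can be chosen for every vertex at once.\<close>

lemma weight_difference:
  assumes "s \<le> 1" "t \<le> 1"
  obtains z where "min s t \<le> z" "z \<le> max s t" "weight t - weight s = (s - t) * (\<alpha> * (\<eta> - z) powr (\<alpha> - 1))"
proof -
  have *: "\<exists>z. s \<le> z \<and> z \<le> t \<and> weight t - weight s = (s - t) * (\<alpha> * (\<eta> - z) powr (\<alpha> - 1))"
    if "s < t" "t \<le> 1" for s t
  proof -
    have "\<exists>z. s < z \<and> z < t \<and> weight t - weight s = (t - s) * - (\<alpha> * (\<eta> - z) powr (\<alpha> - 1))"
      using that by (intro MVT2 DERIV_weight) auto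
    then obtain z where z: "s < z" "z < t"
      "weight t - weight s = (t - s) * - (\<alpha> * (\<eta> - z) powr (\<alpha> - 1))" by blast
    then show ?thesis by (intro exI[of _ z]) (auto simp: algebra_simps)
  qed
  consider "s < t" | "t < s" | "s = t" by linarith
  then show ?thesis
  proof cases
    case 1
    then show ?thesis using *[of s t] assms that by (auto simp: min_def max_def)
  next
    case 2
    then obtain z where z: "t \<le> z" "z \<le> s" "weight s - weight t = (t - s) * (\<alpha> * (\<eta> - z) powr (\<alpha> - 1))"
      using *[of t s] assms by blast
    then have "weight t - weight s = (s - t) * (\<alpha> * (\<eta> - z) powr (\<alpha> - 1))" by (simp add: algebra_simps)
    then show ?thesis using z(1,2) 2 that by (auto simp: min_def max_def)
  next
    case 3
    then show ?thesis using that[of s] by simp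
  qed
qed

text \<open>The two drifts agree on the diagonal, so their difference is controlled by \<open>x\<^sup>1 - x\<^sup>2\<close> alone and
  does not see the deviation of \<open>x\<^sup>1 + x\<^sup>2\<close>.\<close>

lemma diagonal_repelled_near_uniform:
  obtains c r where "c > 0" "r > 0"
    "\<And>x :: real ^ 'v::finite ^ 2. x \<in> prob_pairs \<Longrightarrow> dist x (uniform_pair UNIV) < r \<Longrightarrow>
      (1 + c) * (\<Sum>v\<in>UNIV. (x $ 1 $ v - x $ 2 $ v)\<^sup>2) \<le>
      (\<Sum>v\<in>UNIV. (x $ 1 $ v - x $ 2 $ v) * (\<pi> 1 v x - \<pi> 2 v x))"
proof -
  let ?p = "uniform_pair UNIV :: real ^ 'v ^ 2"
  define \<kappa> where "\<kappa> = real CARD('v)"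
  have "CARD('v) > 0" by simp
  then have \<kappa>: "\<kappa> \<ge> 1" unfolding \<kappa>_def by linarith
  define d where "d z = \<alpha> * (\<eta> - z) powr (\<alpha> - 1)" for z
  define m where "m = weight (1 / \<kappa>)"
  define l where "l = weight 1"
  define R where "R = weight 0"
  define k where "k = d (1 / \<kappa>)"
  \<comment> \<open>\<open>C\<close> is the derivative coefficient of the difference of numerators
    at the uniform point, and \<open>C / m\<close> = 1 + k / (\<kappa> m) is the linear growth
    factor. The constant \<open>c\<close> below is half of its excess over 1.\<close>
  define C where "C = m + k / \<kappa>"
  have i\<kappa>: "0 < 1 / \<kappa>" "1 / \<kappa> \<le> 1" using \<kappa> by auto
  have m: "m > 0" and l: "l > 0" and R: "R > 0" using i\<kappa> by (auto simp: m_def l_def R_def weight_pos)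
  have "\<eta> - 1 / \<kappa> > 0" using \<eta>_gt_1 i\<kappa> by linarith
  then have k: "k > 0" using \<alpha>_pos by (simp add: k_def d_def)
  define c where "c = k / (\<kappa> * m) / 2"
  have c: "c > 0" using k \<kappa> m by (simp add: c_def)
  \<comment> \<open>Here \<open>e\<close> is the tolerance for the perturbed coefficients. The
    quotient will bound the main term from below and the subtracted term the effect of unequal
    normalizations; at \<open>e = 0\<close> the value is 1 + 2 c.\<close>
  have "((\<lambda>e. (C - e) / (m + e) - R * \<kappa> * e / l\<^sup>2) \<longlongrightarrow> (C - 0) / (m + 0) - R * \<kappa> * 0 / l\<^sup>2) (at_right 0)"
    using m l by (intro tendsto_intros) auto
  moreover have "(C - 0) / (m + 0) - R * \<kappa> * 0 / l\<^sup>2 > 1 + c"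
  proof -
    have "C / m = 1 + 2 * c" using m \<kappa> by (simp add: C_def c_def field_simps)
    then show ?thesis using c by simp
  qed
  ultimately have "eventually (\<lambda>e. (C - e) / (m + e) - R * \<kappa> * e / l\<^sup>2 > 1 + c) (at_right 0)"
    by (rule order_tendstoD)
  moreover have "eventually (\<lambda>e. 0 < e \<and> e < C) (at_right (0::real))"
    using m k \<kappa> unfolding eventually_at_right_field C_def by (intro exI[of _ "m + k / \<kappa>"]) (auto simp: add_pos_pos)
  ultimately have "eventually (\<lambda>e. (C - e) / (m + e) - R * \<kappa> * e / l\<^sup>2 > 1 + c \<and> 0 < e \<and> e < C) (at_right 0)"
    by eventually_elim auto
  then obtain e where e: "(C - e) / (m + e) - R * \<kappa> * e / l\<^sup>2 > 1 + c" "0 < e" "e < C"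
    using eventually_happens'[OF trivial_limit_at_right_real] by blast
  \<comment> \<open>The mean value point need not depend continuously on \<open>x\<close>. As an
    independent variable it makes the coefficient jointly continuous, with value \<open>C\<close>
    when all arguments equal 1 / \<kappa>.\<close>
  define A where "A = {..1 :: real} \<times> {..1 :: real} \<times> {..1 :: real}"
  have "continuous_on A (\<lambda>u. (\<eta> - fst (snd u)) powr \<alpha> + fst (snd u) * (\<alpha> * (\<eta> - snd (snd u)) powr (\<alpha> - 1)))"
    using \<eta>_gt_1 by (intro continuous_intros) (auto simp: A_def)
  then have "continuous_on A (\<lambda>u. weight (fst (snd u)) + fst (snd u) * d (snd (snd u)))"
    by (simp add: weight_def d_def)
  then obtain r\<^sub>1 where r1: "r\<^sub>1 > 0" "\<And>u. u \<in> A \<Longrightarrow> dist u (1 / \<kappa>, 1 / \<kappa>, 1 / \<kappa>) < r\<^sub>1 \<Longrightarrow>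
      \<bar>weight (fst (snd u)) + fst (snd u) * d (snd (snd u)) - C\<bar> < e"
  proof (rule continuous_on_near)
    show "(1 / \<kappa>, 1 / \<kappa>, 1 / \<kappa>) \<in> A" using i\<kappa> by (simp add: A_def)
  qed (use e in \<open>auto simp: C_def m_def k_def\<close>)
  have p: "?p \<in> prob_pairs" by (rule uniform_pair_in_prob_pairs) simp
  have tp: "total i ?p = m" for i by (simp add: total_uniform_pair m_def \<kappa>_def)
  obtain r\<^sub>2 where r2: "r\<^sub>2 > 0" "\<And>x. x \<in> prob_pairs \<Longrightarrow> dist x ?p < r\<^sub>2 \<Longrightarrow> \<bar>total 1 x - m\<bar> < e"
    using continuous_on_near[OF continuous_on_total p e(2)] unfolding tp by blast
  define r where "r = min (r\<^sub>1 / 3) r\<^sub>2"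
  show thesis
  proof (rule that[OF c, of r])
    show "r > 0" using r1 r2 by (simp add: r_def)
    fix x :: "real ^ 'v ^ 2" assume x: "x \<in> prob_pairs" and near: "dist x ?p < r"
    define u where "u v = x $ 1 $ v - x $ 2 $ v" for v
    define F\<^sub>1 where "F\<^sub>1 = total 1 x"
    define F\<^sub>2 where "F\<^sub>2 = total 2 x"
    have F: "F\<^sub>1 \<ge> l" "F\<^sub>2 \<ge> l" using total_ge[OF x] by (auto simp: F\<^sub>1_def F\<^sub>2_def l_def)
    have F1: "F\<^sub>1 < m + e" using r2(2)[OF x] near by (simp add: F\<^sub>1_def r_def abs_less_iff)
    have coord: "\<bar>x $ i $ v - 1 / \<kappa>\<bar> < r\<^sub>1 / 3" for i v
    proof -
      have "\<bar>(x - ?p) $ i $ v\<bar> \<le> norm ((x - ?p) $ i)" by (rule component_le_norm_cart)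
      also have "\<dots> \<le> norm (x - ?p)" by (rule Finite_Cartesian_Product.norm_nth_le)
      also have "\<dots> < r\<^sub>1 / 3" using near by (simp add: dist_norm r_def)
      finally show ?thesis by (simp add: uniform_pair_def \<kappa>_def)
    qed
    have "\<exists>z. weight (x $ 2 $ v) - weight (x $ 1 $ v) = u v * d z \<and>
        \<bar>weight (x $ 2 $ v) + x $ 2 $ v * d z - C\<bar> < e" for v
    proof -
      obtain z where z: "min (x $ 1 $ v) (x $ 2 $ v) \<le> z" "z \<le> max (x $ 1 $ v) (x $ 2 $ v)"
        "weight (x $ 2 $ v) - weight (x $ 1 $ v) = (x $ 1 $ v - x $ 2 $ v) * (\<alpha> * (\<eta> - z) powr (\<alpha> - 1))"
        using weight_difference[of "x $ 1 $ v" "x $ 2 $ v"] prob_pairs_le_1[OF x] by metis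
      have "\<bar>z - 1 / \<kappa>\<bar> < r\<^sub>1 / 3" using z(1,2) coord[of 1 v] coord[of 2 v]
        unfolding abs_less_iff min_def max_def by (simp split: if_splits; linarith)
      moreover have "dist (x $ 1 $ v, x $ 2 $ v, z) (1 / \<kappa>, 1 / \<kappa>, 1 / \<kappa>)
          \<le> \<bar>x $ 1 $ v - 1 / \<kappa>\<bar> + (\<bar>x $ 2 $ v - 1 / \<kappa>\<bar> + \<bar>z - 1 / \<kappa>\<bar>)"
        unfolding dist_Pair_Pair dist_real_def
        by (rule order_trans[OF sqrt_sum_squares_le_sum_abs])
          (use sqrt_sum_squares_le_sum_abs[of "x $ 2 $ v - 1 / \<kappa>" "z - 1 / \<kappa>"] in simp)
      ultimately have "dist (x $ 1 $ v, x $ 2 $ v, z) (1 / \<kappa>, 1 / \<kappa>, 1 / \<kappa>) < r\<^sub>1"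
        using coord[of 1 v] coord[of 2 v] by linarith
      moreover have "(x $ 1 $ v, x $ 2 $ v, z) \<in> A"
        using z(2) prob_pairs_le_1[OF x] by (auto simp: A_def max_def split: if_splits intro: order_trans)
      ultimately show ?thesis using r1(2)[of "(x $ 1 $ v, x $ 2 $ v, z)"] z(3) by (auto simp: d_def u_def)
    qed
    then obtain z where z: "\<And>v. weight (x $ 2 $ v) - weight (x $ 1 $ v) = u v * d (z v)"
      "\<And>v. \<bar>weight (x $ 2 $ v) + x $ 2 $ v * d (z v) - C\<bar> < e" by metis
    \<comment> \<open>With this coefficient the difference of the two numerators of the step
      probabilities is exactly \<open>u v * b v\<close>, with no term from the sum of the two
      measures.\<close>
    define b where "b v = weight (x $ 2 $ v) + x $ 2 $ v * d (z v)" for v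
    have ub: "x $ 1 $ v * weight (x $ 2 $ v) - x $ 2 $ v * weight (x $ 1 $ v) = u v * b v" for v
    proof -
      have "weight (x $ 1 $ v) = weight (x $ 2 $ v) - u v * d (z v)" using z(1)[of v] by simp
      then show ?thesis by (simp only: b_def u_def) (simp add: algebra_simps)
    qed
    define q where "q = (\<Sum>v\<in>UNIV. (u v)\<^sup>2)"
    define s where "s = (\<Sum>v\<in>UNIV. \<bar>u v\<bar>)"
    have s0: "s \<ge> 0" unfolding s_def by (intro sum_nonneg) auto
    have sq: "s\<^sup>2 \<le> \<kappa> * q"
      using Cauchy_Schwarz_ineq_sum[of "\<lambda>_. 1" "\<lambda>v. \<bar>u v\<bar>" UNIV] by (simp add: s_def q_def \<kappa>_def)
    have sum_u: "(\<Sum>v\<in>UNIV. u v) = 0"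
      using prob_pairs_sum[OF x] by (simp add: u_def sum_subtractf)
    have "F\<^sub>1 - F\<^sub>2 = (\<Sum>v\<in>UNIV. u v * b v)"
      by (simp add: F\<^sub>1_def F\<^sub>2_def total_def other_walk ub[symmetric] sum_subtractf)
    \<comment> \<open>Since \<open>u\<close> sums to 0, the constant \<open>C\<close> can be
      subtracted. This makes the difference of the normalizations \<open>e\<close> times smaller
      than \<open>u\<close>, and hence its effect on the drift a small multiple of
      \<open>q\<close>.\<close>
    also have "\<dots> = (\<Sum>v\<in>UNIV. u v * (b v - C))"
      using sum_u by (simp add: right_diff_distrib sum_subtractf sum_distrib_right[symmetric])
    finally have "\<bar>F\<^sub>1 - F\<^sub>2\<bar> \<le> (\<Sum>v\<in>UNIV. \<bar>u v * (b v - C)\<bar>)" by (simp add: sum_abs)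
    also have "\<dots> \<le> (\<Sum>v\<in>UNIV. \<bar>u v\<bar> * e)"
      using z(2) unfolding abs_mult b_def by (intro sum_mono mult_left_mono) (auto intro: less_imp_le)
    finally have FF: "\<bar>F\<^sub>1 - F\<^sub>2\<bar> \<le> s * e" by (simp add: s_def sum_distrib_right)
    define T where "T = (\<Sum>v\<in>UNIV. u v * (x $ 2 $ v * weight (x $ 1 $ v)))"
    have "\<bar>T\<bar> \<le> (\<Sum>v\<in>UNIV. \<bar>u v\<bar> * R)"
    proof -
      have "\<bar>T\<bar> \<le> (\<Sum>v\<in>UNIV. \<bar>u v * (x $ 2 $ v * weight (x $ 1 $ v))\<bar>)" unfolding T_def by (rule sum_abs)
      also have "\<dots> \<le> (\<Sum>v\<in>UNIV. \<bar>u v\<bar> * R)"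
        unfolding abs_mult
      proof (intro sum_mono mult_left_mono)
        fix v
        have "\<bar>x $ 2 $ v\<bar> * \<bar>weight (x $ 1 $ v)\<bar> \<le> 1 * R"
          using prob_pairs_nonneg[OF x] prob_pairs_le_1[OF x] weight_pos[of "x $ 1 $ v"]
            weight_antimono[of 0 "x $ 1 $ v"] by (intro mult_mono) (auto simp: R_def)
        then show "\<bar>x $ 2 $ v\<bar> * \<bar>weight (x $ 1 $ v)\<bar> \<le> R" by simp
      qed auto
      finally show ?thesis .
    qed
    then have T: "\<bar>T\<bar> \<le> s * R" by (simp add: s_def sum_distrib_right)
    \<comment> \<open>A difference of quotients: unequal numerators over \<open>F\<^sub>1\<close>,
      plus the numerator of the second walk times the difference of the reciprocals of the
      normalizations.\<close>
    have pi: "\<pi> 1 v x - \<pi> 2 v x = u v * b v / F\<^sub>1 + (x $ 2 $ v * weight (x $ 1 $ v)) * ((F\<^sub>2 - F\<^sub>1) / (F\<^sub>1 * F\<^sub>2))" for v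
      unfolding step_prob_eq ub[symmetric] other_walk F\<^sub>1_def[symmetric] F\<^sub>2_def[symmetric] using F l
      by (simp add: field_simps)
    have "(\<Sum>v\<in>UNIV. u v * (\<pi> 1 v x - \<pi> 2 v x)) =
        (\<Sum>v\<in>UNIV. (u v)\<^sup>2 * (b v / F\<^sub>1)) + T * ((F\<^sub>2 - F\<^sub>1) / (F\<^sub>1 * F\<^sub>2))"
      unfolding pi T_def sum_distrib_right sum.distrib[symmetric]
      by (intro sum.cong) (auto simp: power2_eq_square algebra_simps)
    also have "\<dots> \<ge> q * ((C - e) / (m + e)) - q * (R * \<kappa> * e / l\<^sup>2)"
    proof -
      have "q * ((C - e) / (m + e)) \<le> (\<Sum>v\<in>UNIV. (u v)\<^sup>2 * (b v / F\<^sub>1))"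
        unfolding q_def sum_distrib_right
      proof (intro sum_mono mult_left_mono)
        fix v
        show "(C - e) / (m + e) \<le> b v / F\<^sub>1"
          using z(2)[of v] F F1 l e by (intro frac_le) (auto simp: b_def abs_less_iff)
      qed auto
      moreover have "\<bar>T * ((F\<^sub>2 - F\<^sub>1) / (F\<^sub>1 * F\<^sub>2))\<bar> \<le> q * (R * \<kappa> * e / l\<^sup>2)"
      proof -
        have "\<bar>T * ((F\<^sub>2 - F\<^sub>1) / (F\<^sub>1 * F\<^sub>2))\<bar> = \<bar>T\<bar> * (\<bar>F\<^sub>1 - F\<^sub>2\<bar> / (F\<^sub>1 * F\<^sub>2))"
          using F l by (simp add: abs_mult abs_minus_commute)
        also have "\<dots> \<le> (s * R) * (s * e / (l * l))"
          using T FF F l s0 R e by (intro mult_mono frac_le mult_pos_pos divide_nonneg_nonneg) auto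
        also have "\<dots> = s\<^sup>2 * (R * e / l\<^sup>2)" by (simp add: power2_eq_square)
        also have "\<dots> \<le> (\<kappa> * q) * (R * e / l\<^sup>2)" using sq R e by (intro mult_right_mono) auto
        finally show ?thesis by (simp add: mult_ac)
      qed
      ultimately show ?thesis unfolding abs_le_iff by linarith
    qed
    finally have "q * ((C - e) / (m + e)) - q * (R * \<kappa> * e / l\<^sup>2) \<le> (\<Sum>v\<in>UNIV. u v * (\<pi> 1 v x - \<pi> 2 v x))" .
    moreover have "q * (1 + c) \<le> q * ((C - e) / (m + e) - R * \<kappa> * e / l\<^sup>2)"
      using e(1) by (intro mult_left_mono) (auto simp: q_def sum_nonneg)
    ultimately have "(1 + c) * q \<le> (\<Sum>v\<in>UNIV. u v * (\<pi> 1 v x - \<pi> 2 v x))"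
      by (simp add: right_diff_distrib mult.commute)
    then show "(1 + c) * (\<Sum>v\<in>UNIV. (x $ 1 $ v - x $ 2 $ v)\<^sup>2) \<le>
      (\<Sum>v\<in>UNIV. (x $ 1 $ v - x $ 2 $ v) * (\<pi> 1 v x - \<pi> 2 v x))"
      by (simp add: u_def q_def)
  qed
qed

end

section \<open>Conditional expectations along the path\<close>

context interacting_walks
begin

abbreviation X :: "nat \<Rightarrow> 'a \<Rightarrow> real ^ 'v ^ 2" where
  "X n \<omega> \<equiv> occupation W n \<omega>"

lemma space_walk_history [simp]: "space (walk_history M W n) = space M"
  by (simp add: walk_history_def space_measure_of_conv)

lemma walk_event:
  assumes "k \<ge> 1" shows "W i k -` A \<inter> space M \<in> sets M"
  using measurable_sets[OF random_variable_walk[OF assms], of A i] by simp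

lemma subalgebra_walk_history: "subalgebra M (walk_history M W n)"
proof -
  have "{W i k -` A \<inter> space M | i k A. 1 \<le> k \<and> k \<le> n} \<subseteq> sets M"
    using walk_event by blast
  then have "sets (walk_history M W n) \<subseteq> sets M"
    unfolding walk_history_def using sets.space_closed
    by (subst sets_measure_of) (blast, rule sets.sigma_sets_subset)
  then show ?thesis by (simp add: subalgebra_def)
qed

lemma finite_measure_subalgebra_history: "finite_measure_subalgebra M (walk_history M W n)"
  by unfold_locales (rule subalgebra_walk_history)

lemma measurable_walk_history:
  assumes "1 \<le> k" "k \<le> n"
  shows "W i k \<in> measurable (walk_history M W n) (count_space UNIV)"
proof (rule measurableI)
  fix A :: "'v set"
  have "W i k -` A \<inter> space M \<in> {W i k -` A \<inter> space M | i k A. 1 \<le> k \<and> k \<le> n}"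
    using assms by blast
  moreover have "{W i k -` A \<inter> space M | i k A. 1 \<le> k \<and> k \<le> n} \<subseteq> Pow (space M)" by auto
  ultimately show "W i k -` A \<inter> space (walk_history M W n) \<in> sets (walk_history M W n)"
    by (simp add: walk_history_def)
qed simp

lemma occupation_0: "X 0 \<omega> = (\<chi> i v. 1 / real CARD('v))"
  by (simp add: occupation_def)

lemma occupation_Suc:
  "X (Suc n) \<omega> = move (real CARD('v) + real n) (X n \<omega>) (W 1 (Suc n) \<omega>) (W 2 (Suc n) \<omega>)"
proof -
  have "real CARD('v) + real n > 0" by (simp add: add_pos_nonneg)
  then have D: "real CARD('v) + real n \<noteq> 0" by linarith
  have "X (Suc n) \<omega> $ i $ u = ((real CARD('v) + real n) * X n \<omega> $ i $ u + of_bool (W i (Suc n) \<omega> = u)) /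
      (real CARD('v) + real n + 1)" for i u
    using D by (simp add: occupation_def del: sum_of_bool_eq)
  then show ?thesis by (simp add: vec_eq_iff forall_2)
qed

text \<open>\<open>g\<close> can be arbitrary because the state takes finitely many values at each
  time. The last step is split according to the two vertices chosen, and the induction hypothesis is
  applied to \<open>g\<close> composed with each possible move.\<close>

lemma measurable_occupation:
  fixes g :: "real ^ 'v ^ 2 \<Rightarrow> real"
  assumes "n \<le> m"
  shows "(\<lambda>\<omega>. g (X n \<omega>)) \<in> borel_measurable (walk_history M W m)"
  using assms
proof (induction n arbitrary: g)
  case 0
  then show ?case by (simp add: occupation_0)
next
  case (Suc n)
  have [measurable]: "W i (Suc n) \<in> measurable (walk_history M W m) (count_space UNIV)" for i
    using Suc.prems by (intro measurable_walk_history) auto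
  have [measurable]: "(\<lambda>\<omega>. g (move (real CARD('v) + real n) (X n \<omega>) v w)) \<in> borel_measurable (walk_history M W m)" for v w
    using Suc by simp
  have "g (X (Suc n) \<omega>) = (\<Sum>v\<in>UNIV. \<Sum>w\<in>UNIV. if W 1 (Suc n) \<omega> = v \<and> W 2 (Suc n) \<omega> = w then
      g (move (real CARD('v) + real n) (X n \<omega>) v w) else 0)" for \<omega>
  proof -
    have "(\<Sum>w\<in>UNIV. if W 1 (Suc n) \<omega> = v \<and> W 2 (Suc n) \<omega> = w then g (move (real CARD('v) + real n) (X n \<omega>) v w) else 0)
      = (if W 1 (Suc n) \<omega> = v then g (X (Suc n) \<omega>) else 0)" for v
      by (cases "W 1 (Suc n) \<omega> = v") (simp_all add: occupation_Suc)
    then show ?thesis by simp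
  qed
  then show ?case by simp
qed

lemma measurable_occupation_M [measurable]:
  fixes g :: "real ^ 'v ^ 2 \<Rightarrow> real"
  shows "(\<lambda>\<omega>. g (X n \<omega>)) \<in> borel_measurable M"
  using measurable_from_subalg[OF subalgebra_walk_history measurable_occupation[OF order_refl]] .

lemma joint_step_law:
  "AE \<omega> in M. real_cond_exp M (walk_history M W n)
      (indicator {\<omega> \<in> space M. W 1 (Suc n) \<omega> = v \<and> W 2 (Suc n) \<omega> = w}) \<omega> =
    step_prob \<alpha> \<eta> 1 v (X n \<omega>) * step_prob \<alpha> \<eta> 2 w (X n \<omega>)"
  using cond_indep_step[of n, unfolded cond_indep_var_def, rule_format, of "{v}" "{w}"]
    step_law[of n 1 v] step_law[of n 2 w]
  by (auto simp: cond_prob_given_def)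

text \<open>The tower property: \<open>h\<close> is split over the values of the next pair of
  vertices, and each indicator is replaced by its conditional expectation, since its coefficient is
  known at time \<open>n\<close>.\<close>

lemma integral_step:
  assumes h [measurable]: "\<And>v w. (\<lambda>\<omega>. h \<omega> v w) \<in> borel_measurable (walk_history M W n)"
    and bound: "\<And>\<omega> v w. \<bar>h \<omega> v w\<bar> \<le> B"
  shows "(\<integral>\<omega>. h \<omega> (W 1 (Suc n) \<omega>) (W 2 (Suc n) \<omega>) \<partial>M) = (\<integral>\<omega>. step_mean \<alpha> \<eta> (X n \<omega>) (h \<omega>) \<partial>M)"
    and "integrable M (\<lambda>\<omega>. h \<omega> (W 1 (Suc n) \<omega>) (W 2 (Suc n) \<omega>))"
    and "integrable M (\<lambda>\<omega>. step_mean \<alpha> \<eta> (X n \<omega>) (h \<omega>))"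
proof -
  interpret F: finite_measure_subalgebra M "walk_history M W n"
    by (rule finite_measure_subalgebra_history)
  have [measurable]: "W i (Suc n) \<in> measurable M (count_space UNIV)" for i
    by (simp add: random_variable_walk)
  have hM [measurable]: "(\<lambda>\<omega>. h \<omega> v w) \<in> borel_measurable M" for v w
    using measurable_from_subalg[OF subalgebra_walk_history h] .
  define I :: "'v \<Rightarrow> 'v \<Rightarrow> 'a \<Rightarrow> real"
    where "I v w = indicator {\<omega> \<in> space M. W 1 (Suc n) \<omega> = v \<and> W 2 (Suc n) \<omega> = w}" for v w
  have I [measurable]: "I v w \<in> borel_measurable M" for v w
    unfolding I_def by measurable
  have int: "integrable M (\<lambda>\<omega>. h \<omega> v w * I v w \<omega>)" for v w
    by (rule integrable_const_bound[where B=B])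
      (use bound in \<open>auto simp: I_def indicator_def intro: order_trans[OF abs_ge_zero]\<close>)
  have eq: "(\<integral>\<omega>. h \<omega> v w * I v w \<omega> \<partial>M) =
      (\<integral>\<omega>. step_prob \<alpha> \<eta> 1 v (X n \<omega>) * step_prob \<alpha> \<eta> 2 w (X n \<omega>) * h \<omega> v w \<partial>M)" (is "_ = ?R")
    and inth: "integrable M (\<lambda>\<omega>. step_prob \<alpha> \<eta> 1 v (X n \<omega>) * step_prob \<alpha> \<eta> 2 w (X n \<omega>) * h \<omega> v w)" for v w
  proof -
    note c = F.real_cond_exp_intg[OF int h I, of v w]
    have ae: "AE \<omega> in M. h \<omega> v w * real_cond_exp M (walk_history M W n) (I v w) \<omega>
        = step_prob \<alpha> \<eta> 1 v (X n \<omega>) * step_prob \<alpha> \<eta> 2 w (X n \<omega>) * h \<omega> v w"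
      using joint_step_law[of n v w] unfolding I_def by eventually_elim simp
    have [measurable]: "real_cond_exp M (walk_history M W n) (I v w) \<in> borel_measurable M"
      by (rule borel_measurable_cond_exp2)
    have m2: "(\<lambda>\<omega>. step_prob \<alpha> \<eta> i v (X n \<omega>)) \<in> borel_measurable M" for i v
      by (rule measurable_occupation_M)
    note [measurable] = m2
    show "(\<integral>\<omega>. h \<omega> v w * I v w \<omega> \<partial>M) = ?R"
      unfolding c(2)[symmetric] by (rule integral_cong_AE) (use ae in measurable)
    show "integrable M (\<lambda>\<omega>. step_prob \<alpha> \<eta> 1 v (X n \<omega>) * step_prob \<alpha> \<eta> 2 w (X n \<omega>) * h \<omega> v w)"
      by (rule integrable_cong_AE_imp[OF c(1)]) (use ae in \<open>measurable | auto\<close>)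
  qed
  have split: "h \<omega> (W 1 (Suc n) \<omega>) (W 2 (Suc n) \<omega>) = (\<Sum>v\<in>UNIV. \<Sum>w\<in>UNIV. h \<omega> v w * I v w \<omega>)"
    if "\<omega> \<in> space M" for \<omega>
  proof -
    have "(\<Sum>w\<in>UNIV. h \<omega> v w * I v w \<omega>)
      = (if W 1 (Suc n) \<omega> = v then h \<omega> v (W 2 (Suc n) \<omega>) else 0)" for v
      using that by (cases "W 1 (Suc n) \<omega> = v") (simp_all add: I_def indicator_def of_bool_def if_distrib cong: if_cong)
    then show ?thesis by simp
  qed
  have int_sum: "integrable M (\<lambda>\<omega>. \<Sum>v\<in>UNIV. \<Sum>w\<in>UNIV. h \<omega> v w * I v w \<omega>)"
    by (intro Bochner_Integration.integrable_sum int)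
  show "integrable M (\<lambda>\<omega>. h \<omega> (W 1 (Suc n) \<omega>) (W 2 (Suc n) \<omega>))"
    using int_sum by (subst Bochner_Integration.integrable_cong[OF refl split])
  show "integrable M (\<lambda>\<omega>. step_mean \<alpha> \<eta> (X n \<omega>) (h \<omega>))"
    unfolding step_mean_def by (intro Bochner_Integration.integrable_sum inth)
  have "(\<integral>\<omega>. h \<omega> (W 1 (Suc n) \<omega>) (W 2 (Suc n) \<omega>) \<partial>M) = (\<integral>\<omega>. (\<Sum>v\<in>UNIV. \<Sum>w\<in>UNIV. h \<omega> v w * I v w \<omega>) \<partial>M)"
    by (rule Bochner_Integration.integral_cong[OF refl split])
  also have "\<dots> = (\<Sum>v\<in>UNIV. \<Sum>w\<in>UNIV. \<integral>\<omega>. h \<omega> v w * I v w \<omega> \<partial>M)"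
    using int by (simp add: Bochner_Integration.integral_sum Bochner_Integration.integrable_sum)
  also have "\<dots> = (\<integral>\<omega>. step_mean \<alpha> \<eta> (X n \<omega>) (h \<omega>) \<partial>M)"
    using inth unfolding step_mean_def
    by (simp add: Bochner_Integration.integral_sum Bochner_Integration.integrable_sum eq)
  finally show "(\<integral>\<omega>. h \<omega> (W 1 (Suc n) \<omega>) (W 2 (Suc n) \<omega>) \<partial>M) = (\<integral>\<omega>. step_mean \<alpha> \<eta> (X n \<omega>) (h \<omega>) \<partial>M)" .
qed

end

section \<open>A criterion for nonconvergence to a repelling point\<close>

locale repelling_walks = interacting_walks M \<alpha> \<eta> W + repulsion \<alpha> \<eta>
  for M :: "'a measure" and \<alpha> \<eta> :: real and W :: "2 \<Rightarrow> nat \<Rightarrow> 'a \<Rightarrow> 'v::finite"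
begin

lemma occupation_in_prob_pairs: "X n \<omega> \<in> prob_pairs"
proof (induction n)
  case 0
  show ?case by (simp add: prob_pairs_def prob_simplex_def occupation_0)
next
  case (Suc n)
  then show ?case by (simp add: occupation_Suc move_in_prob_pairs)
qed

text \<open>Every vertex carries one initial unit of occupation. Near a uniform pair on a proper
  subset this bound takes the place of the noise.\<close>

lemma occupation_ge: "X n \<omega> $ i $ v \<ge> 1 / (real CARD('v) + real n)"
  unfolding occupation_def by (auto intro!: divide_right_mono sum_nonneg simp del: sum_of_bool_eq)

text \<open>The conditions on a step near \<open>p\<close> are the inputs of the barrier estimates:
  growth of the mean with surplus 2 b / D^2, a second moment of order q / D^2 + 1 / D^4, and no loss
  beyond a quarter of q + b / D.\<close>

lemma escape:
  fixes q :: "real ^ 'v ^ 2 \<Rightarrow> real"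
  assumes pos: "b > 0" "c > 0" "C \<ge> 0" "r > 0"
    and cont: "isCont q p" "q p = 0"
    and q: "\<And>x. x \<in> prob_pairs \<Longrightarrow> 0 \<le> q x" "\<And>x. x \<in> prob_pairs \<Longrightarrow> q x \<le> Q"
    and step: "\<And>D x. D \<ge> D\<^sub>0 \<Longrightarrow> x \<in> prob_pairs \<Longrightarrow> dist x p < r \<Longrightarrow> (\<And>i v. x $ i $ v \<ge> 1 / D) \<Longrightarrow>
      (c * q x + 2 * b / D) / D \<le> E x (\<lambda>v w. q (move D x v w) - q x) \<and>
      E x (\<lambda>v w. (q (move D x v w) - q x)\<^sup>2) \<le> C * (q x + 1 / D\<^sup>2) / D\<^sup>2 \<and>
      (\<forall>v w. - (q x + b / D) / 4 \<le> q (move D x v w) - q x)"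
  shows "AE \<omega> in M. \<not> (\<lambda>n. X n \<omega>) \<longlonglongrightarrow> p"
proof -
  define D where "D n = real CARD('v) + real n" for n
  define K where "K = 16 * C + 4 * Q + b + 1"
  define c' where "c' = 4 * C * (K + 4 * C / c)\<^sup>2 / b\<^sup>2"
  \<comment> \<open>\<open>L\<close> dominates the logarithm because \<open>D n \<ge> 1\<close>, so
    \<open>H\<close> is nonnegative. Both the truncation by \<open>I\<close> and Fatou's lemma rely
    on this.\<close>
  define L where "L = ln (b + Q)"
  define H where "H n x = L - barrier b K c' (D n) (q x)" for n x
  have Q: "Q \<ge> 0" using q[OF occupation_in_prob_pairs[of 0 undefined]] by linarith
  have c': "c' \<ge> 0" using pos by (simp add: c'_def)
  have K: "K > 0" "b \<le> K" using pos Q by (simp_all add: K_def)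
  have D1: "D n \<ge> 1" for n
  proof -
    have "CARD('v) > 0" by simp
    then have "real CARD('v) \<ge> 1" by linarith
    then show ?thesis unfolding D_def by linarith
  qed
  have DSuc: "D (Suc n) = D n + 1" for n by (simp add: D_def)
  have H_ge: "L - ln (b / D n + q x) \<le> H n x" if "x \<in> prob_pairs" for n x
    using q(1)[OF that] c' K D1[of n] by (simp add: H_def barrier_def)
  have H_nonneg: "0 \<le> H n x" if "x \<in> prob_pairs" for n x
  proof -
    have "b / D n \<le> b / 1" using pos D1[of n] by (intro divide_left_mono) auto
    then have "b / D n + q x \<le> b + Q" using q(2)[OF that] by simp
    moreover have "0 < b / D n + q x" using pos D1[of n] q(1)[OF that] by (simp add: add_pos_nonneg)
    ultimately have "ln (b / D n + q x) \<le> L" unfolding L_def by simp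
    then show ?thesis using H_ge[OF that, of n] by simp
  qed
  have H_le: "H n x \<le> L - ln (b / D n) + c' / K" if "x \<in> prob_pairs" for n x
  proof -
    have "0 < b / D n" using pos D1[of n] by simp
    then have "ln (b / D n) \<le> ln (b / D n + q x)" using q(1)[OF that] by simp
    moreover have "c' / (K + D n * q x) \<le> c' / K"
      using c' K q(1)[OF that] D1[of n] by (intro divide_left_mono mult_pos_pos add_pos_nonneg) auto
    ultimately show ?thesis by (simp add: H_def barrier_def)
  qed
  have H_bd: "0 \<le> L - ln (b / D n) + c' / K" for n
    using order_trans[OF H_nonneg H_le] occupation_in_prob_pairs[of 0 undefined] by blast
  \<comment> \<open>The thresholds come from the step hypothesis, from
    \<open>barrier_mean_increment\<close> and from \<open>barrier_gain_nonneg\<close>.\<close>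
  obtain N where N: "\<And>n. n \<ge> N \<Longrightarrow> D n \<ge> Max {D\<^sub>0, 3, 1 / b, (4 * C + 4 * b\<^sup>2) / b\<^sup>2}"
  proof -
    obtain N where "real N \<ge> Max {D\<^sub>0, 3, 1 / b, (4 * C + 4 * b\<^sup>2) / b\<^sup>2}" using real_arch_simple by blast
    then show ?thesis by (intro that[of N]) (simp add: D_def)
  qed
  have super: "E (X n \<omega>) (\<lambda>v w. H (Suc n) (move (D n) (X n \<omega>) v w)) \<le> H n (X n \<omega>)"
    if n: "n \<ge> N" and near: "dist (X n \<omega>) p < r" for n \<omega>
  proof -
    let ?x = "X n \<omega>"
    have x: "?x \<in> prob_pairs" by (rule occupation_in_prob_pairs)
    have Dn: "D n \<ge> D\<^sub>0" "D n \<ge> 3" "D n \<ge> 1 / b" "D n \<ge> (4 * C + 4 * b\<^sup>2) / b\<^sup>2"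
      by (rule order_trans[OF Max_ge N[OF n]]; simp)+
    have "1 / D n \<le> ?x $ i $ v" for i v unfolding D_def by (rule occupation_ge)
    note s = step[OF Dn(1) x near this]
    have "0 \<le> barrier_gain b K c' (D n) (q ?x) (E ?x (\<lambda>v w. q (move (D n) ?x v w) - q ?x))
        (E ?x (\<lambda>v w. (q (move (D n) ?x v w) - q ?x)\<^sup>2))"
      using s unfolding K_def c'_def
      by (intro barrier_gain_nonneg pos Q Dn D1 q x) auto
    also have "\<dots> \<le> E ?x (\<lambda>v w. barrier b K c' (D n + 1) (q (move (D n) ?x v w))) - barrier b K c' (D n) (q ?x)"
      using barrier_mean_increment[where q = q, OF x Dn(2) pos(1) K(2) c' q(1)[OF x]] s by (simp add: algebra_simps)
    finally show ?thesis
      by (simp add: H_def DSuc step_mean_diff step_mean_const[OF x])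
  qed
  \<comment> \<open>The process is killed rather than stopped on leaving the ball: multiplication by
    this indicator sets the nonnegative \<open>H\<close> to 0, which only lowers the mean.\<close>
  define I where "I m n \<omega> = (\<Prod>k\<in>{m..n}. if dist (X k \<omega>) p < r then 1 else 0 :: real)" for m n \<omega>
  have I01: "I m n \<omega> \<ge> 0" "I m n \<omega> \<le> 1" for m n \<omega>
    unfolding I_def by (intro prod_nonneg prod_le_1; simp)+
  have I_meas: "I m n \<in> borel_measurable (walk_history M W n)" for m n
    unfolding I_def[abs_def] by (intro borel_measurable_prod measurable_occupation) auto
  have dec: "integrable M (\<lambda>\<omega>. H n (X n \<omega>) * I m n \<omega>) \<and>
      (\<integral>\<omega>. H n (X n \<omega>) * I m n \<omega> \<partial>M) \<le> (\<integral>\<omega>. H m (X m \<omega>) * I m m \<omega> \<partial>M)"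
    if m: "m \<ge> N" and "n \<ge> m" for m n
    using \<open>n \<ge> m\<close>
  proof (induction n rule: dec_induct)
    case base
    have "integrable M (\<lambda>\<omega>. H m (X m \<omega>) * I m m \<omega>)"
    proof (rule integrable_const_bound)
      show "AE \<omega> in M. norm (H m (X m \<omega>) * I m m \<omega>) \<le> (L - ln (b / D m) + c' / K) * 1"
        unfolding norm_mult
        using H_le[OF occupation_in_prob_pairs, of m] H_nonneg[OF occupation_in_prob_pairs, of m] I01
          H_bd[of m]
        by (intro AE_I2 mult_mono) auto
      show "(\<lambda>\<omega>. H m (X m \<omega>) * I m m \<omega>) \<in> borel_measurable M"
        using measurable_from_subalg[OF subalgebra_walk_history I_meas]
        by (intro borel_measurable_times measurable_occupation_M) auto
    qed
    then show ?case by simp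
  next
    case (step n)
    \<comment> \<open>The indicator stops at time \<open>n\<close>, so it is known before the step;
      extending it to \<open>Suc n\<close> afterwards only decreases the product.\<close>
    define h where "h \<omega> v w = H (Suc n) (move (D n) (X n \<omega>) v w) * I m n \<omega>" for \<omega> v w
    have hX: "h \<omega> (W 1 (Suc n) \<omega>) (W 2 (Suc n) \<omega>) = H (Suc n) (X (Suc n) \<omega>) * I m n \<omega>" for \<omega>
      by (simp add: h_def D_def occupation_Suc)
    have h1: "(\<lambda>\<omega>. h \<omega> v w) \<in> borel_measurable (walk_history M W n)" for v w
      unfolding h_def by (intro borel_measurable_times I_meas measurable_occupation order_refl)
    have mv: "move (D n) (X n \<omega>) v w \<in> prob_pairs" for v w \<omega>
      using D1[of n] by (intro move_in_prob_pairs occupation_in_prob_pairs) auto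
    have h2: "\<bar>h \<omega> v w\<bar> \<le> (L - ln (b / D (Suc n)) + c' / K) * 1" for \<omega> v w
      unfolding h_def abs_mult
      using H_le[OF mv, of "Suc n" \<omega> v w] H_nonneg[OF mv, of "Suc n" \<omega> v w] I01[of m n \<omega>]
      by (intro mult_mono) auto
    note S = integral_step[of h, OF h1 h2]
    have Imono: "I m (Suc n) \<omega> \<le> I m n \<omega>" for \<omega>
      using \<open>m \<le> n\<close> I01[of m n \<omega>] by (simp add: I_def mult_left_le)
    have le: "H (Suc n) (X (Suc n) \<omega>) * I m (Suc n) \<omega> \<le> h \<omega> (W 1 (Suc n) \<omega>) (W 2 (Suc n) \<omega>)" for \<omega>
      unfolding hX by (intro mult_left_mono Imono H_nonneg occupation_in_prob_pairs)
    have nn: "0 \<le> H (Suc n) (X (Suc n) \<omega>) * I m (Suc n) \<omega>" for \<omega>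
      by (intro mult_nonneg_nonneg I01 H_nonneg occupation_in_prob_pairs)
    have int: "integrable M (\<lambda>\<omega>. H (Suc n) (X (Suc n) \<omega>) * I m (Suc n) \<omega>)"
    proof (rule Bochner_Integration.integrable_bound[OF S(2)])
      show "(\<lambda>\<omega>. H (Suc n) (X (Suc n) \<omega>) * I m (Suc n) \<omega>) \<in> borel_measurable M"
        using measurable_from_subalg[OF subalgebra_walk_history I_meas]
        by (intro borel_measurable_times measurable_occupation_M) auto
      show "AE \<omega> in M. norm (H (Suc n) (X (Suc n) \<omega>) * I m (Suc n) \<omega>) \<le> norm (h \<omega> (W 1 (Suc n) \<omega>) (W 2 (Suc n) \<omega>))"
        using le nn by (intro AE_I2) (smt (verit) real_norm_def)
    qed
    have "(\<integral>\<omega>. H (Suc n) (X (Suc n) \<omega>) * I m (Suc n) \<omega> \<partial>M) \<le> (\<integral>\<omega>. h \<omega> (W 1 (Suc n) \<omega>) (W 2 (Suc n) \<omega>) \<partial>M)"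
      by (rule integral_mono[OF int S(2) le])
    also have "\<dots> = (\<integral>\<omega>. E (X n \<omega>) (h \<omega>) \<partial>M)" by (rule S(1))
    also have "\<dots> \<le> (\<integral>\<omega>. H n (X n \<omega>) * I m n \<omega> \<partial>M)"
    proof (rule integral_mono[OF S(3)])
      show "integrable M (\<lambda>\<omega>. H n (X n \<omega>) * I m n \<omega>)" using step.IH by simp
      fix \<omega>
      have e: "E (X n \<omega>) (h \<omega>) = I m n \<omega> * E (X n \<omega>) (\<lambda>v w. H (Suc n) (move (D n) (X n \<omega>) v w))"
        unfolding step_mean_mult[symmetric] h_def by (simp add: mult.commute)
      show "E (X n \<omega>) (h \<omega>) \<le> H n (X n \<omega>) * I m n \<omega>"
      proof (cases "dist (X n \<omega>) p < r")
        case True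
        then show ?thesis
          unfolding e using super[of n \<omega>] m \<open>m \<le> n\<close> I01(1)[of m n \<omega>]
          by (simp add: mult.commute mult_left_mono)
      next
        case False
        then have "I m n \<omega> = 0" using \<open>m \<le> n\<close> by (auto simp: I_def)
        then show ?thesis unfolding e by simp
      qed
    qed
    finally show ?case using int step.IH by simp
  qed
  have ae: "AE \<omega> in M. \<not> ((\<forall>k\<ge>m. dist (X k \<omega>) p < r) \<and> (\<lambda>n. X n \<omega>) \<longlonglongrightarrow> p)" if m: "m \<ge> N" for m
  proof -
    let ?u = "\<lambda>n \<omega>. ennreal (H n (X n \<omega>) * I m n \<omega>)"
    define B where "B = (\<integral>\<omega>. H m (X m \<omega>) * I m m \<omega> \<partial>M)"
    have meas: "?u n \<in> borel_measurable M" if "n \<ge> m" for n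
      using dec[OF m that] by (intro measurable_compose[OF borel_measurable_integrable measurable_ennreal]) auto
    have nn: "0 \<le> H n (X n \<omega>) * I m n \<omega>" for n \<omega>
      by (intro mult_nonneg_nonneg I01 H_nonneg occupation_in_prob_pairs)
    have bd: "(\<integral>\<^sup>+\<omega>. ?u n \<omega> \<partial>M) \<le> ennreal B" if "n \<ge> m" for n
      using dec[OF m that] nn unfolding B_def
      by (subst nn_integral_eq_integral) (auto intro: ennreal_leI)
    let ?v = "\<lambda>n. ?u (n + m)"
    have vm: "?v n \<in> borel_measurable M" for n by (rule meas) simp
    have "(\<integral>\<^sup>+\<omega>. liminf (\<lambda>n. ?v n \<omega>) \<partial>M) \<le> liminf (\<lambda>n. \<integral>\<^sup>+\<omega>. ?v n \<omega> \<partial>M)"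
      by (rule nn_integral_liminf[OF vm])
    also have "\<dots> \<le> liminf (\<lambda>n. ennreal B)"
      by (intro Liminf_mono always_eventually allI bd) simp
    also have "\<dots> = ennreal B" by (simp add: Liminf_const)
    finally have "(\<integral>\<^sup>+\<omega>. liminf (\<lambda>n. ?v n \<omega>) \<partial>M) \<noteq> \<infinity>" by (auto simp: top_unique)
    then have "AE \<omega> in M. liminf (\<lambda>n. ?v n \<omega>) \<noteq> \<infinity>"
      by (intro nn_integral_noteq_infinite borel_measurable_liminf vm)
    then show ?thesis
    proof eventually_elim
      case (elim \<omega>)
      show ?case
      proof
        assume A: "(\<forall>k\<ge>m. dist (X k \<omega>) p < r) \<and> (\<lambda>n. X n \<omega>) \<longlonglongrightarrow> p"
        then have I1: "I m n \<omega> = 1" for n by (simp add: I_def)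
        have "(\<lambda>n. q (X n \<omega>)) \<longlonglongrightarrow> 0"
          using isCont_tendsto_compose[OF cont(1)] A cont(2) by fastforce
        moreover have "(\<lambda>n. b / D n) \<longlonglongrightarrow> 0"
          unfolding D_def
          by (intro real_tendsto_divide_at_top[OF tendsto_const] filterlim_tendsto_add_at_top[OF tendsto_const]
              filterlim_real_sequentially)
        ultimately have l0: "(\<lambda>n. b / D n + q (X n \<omega>)) \<longlonglongrightarrow> 0"
          using tendsto_add[of "\<lambda>n. b / D n" 0 sequentially "\<lambda>n. q (X n \<omega>)" 0] by simp
        have "b / D n + q (X n \<omega>) > 0" for n
          using pos D1[of n] q(1)[OF occupation_in_prob_pairs, of n \<omega>] by (simp add: add_pos_nonneg)
        with l0 have "filterlim (\<lambda>n. b / D n + q (X n \<omega>)) (at_right 0) sequentially"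
          by (intro tendsto_imp_filterlim_at_right always_eventually) auto
        then have "filterlim (\<lambda>n. ln (b / D n + q (X n \<omega>))) at_bot sequentially"
          by (rule filterlim_compose[OF ln_at_0])
        then have "filterlim (\<lambda>n. - ln (b / D n + q (X n \<omega>))) at_top sequentially"
          by (simp add: filterlim_uminus_at_bot)
        then have "filterlim (\<lambda>n. L + - ln (b / D n + q (X n \<omega>))) at_top sequentially"
          by (intro filterlim_tendsto_add_at_top[OF tendsto_const])
        then have "filterlim (\<lambda>n. H n (X n \<omega>)) at_top sequentially"
          by (rule filterlim_at_top_mono) (use H_ge[OF occupation_in_prob_pairs] in \<open>auto simp: algebra_simps\<close>)
        then have "((\<lambda>n. ennreal (H n (X n \<omega>))) \<longlongrightarrow> \<infinity>) sequentially"
          by (simp add: ennreal_tendsto_top_eq_at_top)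
        then have "(\<lambda>n. ?v n \<omega>) \<longlonglongrightarrow> \<infinity>"
          using I1 LIMSEQ_ignore_initial_segment[of "\<lambda>n. ennreal (H n (X n \<omega>))" \<infinity> m] by simp
        then have "liminf (\<lambda>n. ?v n \<omega>) = \<infinity>"
          by (intro lim_imp_Liminf) auto
        with elim show False by simp
      qed
    qed
  qed
  \<comment> \<open>The time from which a convergent path stays in the ball is random but has
    countably many possible values.\<close>
  have "AE \<omega> in M. \<forall>m. m \<ge> N \<longrightarrow> \<not> ((\<forall>k\<ge>m. dist (X k \<omega>) p < r) \<and> (\<lambda>n. X n \<omega>) \<longlonglongrightarrow> p)"
    using ae by (simp add: AE_all_countable)
  then show ?thesis
  proof eventually_elim
    case (elim \<omega>)
    show ?case
    proof
      assume lim: "(\<lambda>n. X n \<omega>) \<longlonglongrightarrow> p"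
      then obtain m where "\<And>k. k \<ge> m \<Longrightarrow> dist (X k \<omega>) p < r"
        using pos(4) by (auto simp: lim_sequentially)
      then have "\<forall>k\<ge>max m N. dist (X k \<omega>) p < r" by simp
      with elim lim show False by (meson max.cobounded2)
    qed
  qed
qed

end

section \<open>Almost sure vanishing of the gap\<close>

context repelling_walks
begin

lemma integrable_occupation:
  fixes g :: "real ^ 'v ^ 2 \<Rightarrow> real"
  assumes "\<And>x. x \<in> prob_pairs \<Longrightarrow> \<bar>g x\<bar> \<le> B"
  shows "integrable M (\<lambda>\<omega>. g (X n \<omega>))"
  by (rule integrable_const_bound[where B = B])
    (use assms occupation_in_prob_pairs in auto)

text \<open>The expected overlap lies between 0 and 1, so its decrements telescope and bound the sum
  of the expected weighted gaps. A nonnegative series with finite mean is almost surely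
  finite.\<close>

lemma AE_summable_gap:
  "AE \<omega> in M. summable (\<lambda>n. (real CARD('v) + real n) / (real CARD('v) + real n + 1)\<^sup>2 *
     (gap 1 (X n \<omega>) + gap 2 (X n \<omega>)))"
proof -
  define D where "D n = real CARD('v) + real n" for n
  define g where "g x = gap 1 x + gap 2 x" for x :: "real ^ 'v ^ 2"
  define w where "w n = D n / (D n + 1)\<^sup>2" for n
  have D0: "D n \<ge> 0" for n by (simp add: D_def)
  have w0: "w n \<ge> 0" for n using D0[of n] by (simp add: w_def)
  have g0: "g x \<ge> 0" if "x \<in> prob_pairs" for x
    using gap_nonneg[OF that] by (simp add: g_def)
  obtain B where B: "\<And>x. x \<in> prob_pairs \<Longrightarrow> \<bar>g x\<bar> \<le> B"
  proof -
    have "continuous_on prob_pairs g" unfolding g_def by (intro continuous_intros continuous_on_gap)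
    then have "bounded (g ` prob_pairs)"
      by (intro compact_imp_bounded compact_continuous_image compact_prob_pairs)
    then show ?thesis using that unfolding bounded_iff by (metis imageI real_norm_def)
  qed
  have int_g: "integrable M (\<lambda>\<omega>. g (X n \<omega>))" for n by (rule integrable_occupation[OF B])
  have int_o: "integrable M (\<lambda>\<omega>. overlap (X n \<omega>))" for n
    by (rule integrable_occupation[where B = 1]) (simp add: overlap_nonneg overlap_le_1)
  define a where "a n = (\<integral>\<omega>. overlap (X n \<omega>) \<partial>M)" for n
  have step: "w n * (\<integral>\<omega>. g (X n \<omega>) \<partial>M) \<le> a n - a (Suc n) + 1 / (D n + 1)\<^sup>2" for n
  proof -
    have b: "\<bar>overlap (move (D n) (X n \<omega>) v w)\<bar> \<le> 1" for \<omega> v w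
      using move_in_prob_pairs[OF occupation_in_prob_pairs D0] by (simp add: overlap_nonneg overlap_le_1)
    note S = integral_step[of "\<lambda>\<omega> v w. overlap (move (D n) (X n \<omega>) v w)" n 1]
    have S1: "a (Suc n) = (\<integral>\<omega>. E (X n \<omega>) (\<lambda>v w. overlap (move (D n) (X n \<omega>) v w)) \<partial>M)"
      unfolding a_def occupation_Suc D_def[symmetric]
      by (rule S(1)) (auto intro: measurable_occupation simp: b)
    have S3: "integrable M (\<lambda>\<omega>. E (X n \<omega>) (\<lambda>v w. overlap (move (D n) (X n \<omega>) v w)))"
      by (rule S(3)) (auto intro: measurable_occupation simp: b)
    have int: "integrable M (\<lambda>\<omega>. overlap (X n \<omega>) - w n * g (X n \<omega>) + 1 / (D n + 1)\<^sup>2)"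
      using int_o[of n] int_g[of n] by simp
    have "a (Suc n) \<le> (\<integral>\<omega>. overlap (X n \<omega>) - w n * g (X n \<omega>) + 1 / (D n + 1)\<^sup>2 \<partial>M)"
      unfolding S1 g_def w_def
      by (rule integral_mono[OF S3 int[unfolded g_def w_def]])
        (rule step_mean_overlap[OF occupation_in_prob_pairs D0])
    also have "\<dots> = a n - w n * (\<integral>\<omega>. g (X n \<omega>) \<partial>M) + 1 / (D n + 1)\<^sup>2"
      using int_o[of n] int_g[of n] by (simp add: a_def prob_space)
    finally show ?thesis by simp
  qed
  have a01: "0 \<le> a n" "a n \<le> 1" for n
  proof -
    show "0 \<le> a n" unfolding a_def
      by (intro Bochner_Integration.integral_nonneg overlap_nonneg occupation_in_prob_pairs)
    have "a n \<le> (\<integral>\<omega>. 1 \<partial>M)" unfolding a_def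
      by (intro integral_mono int_o overlap_le_1 occupation_in_prob_pairs) simp
    then show "a n \<le> 1" by (simp add: prob_space)
  qed
  have sq: "summable (\<lambda>n. 1 / (real n + 1)\<^sup>2)"
    using inverse_power_summable[of 2, where 'a = real] summable_Suc_iff[of "\<lambda>n. inverse (real n ^ 2)"]
    by (simp add: inverse_eq_divide add.commute)
  define B' where "B' = 1 + (\<Sum>n. 1 / (real n + 1)\<^sup>2)"
  have partial: "(\<Sum>n<N. w n * (\<integral>\<omega>. g (X n \<omega>) \<partial>M)) \<le> B'" for N
  proof -
    have "(\<Sum>n<N. w n * (\<integral>\<omega>. g (X n \<omega>) \<partial>M)) \<le> (\<Sum>n<N. (a n - a (Suc n)) + 1 / (real n + 1)\<^sup>2)"
    proof (rule sum_mono)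
      fix n
      have "1 / (D n + 1)\<^sup>2 \<le> 1 / (real n + 1)\<^sup>2"
        by (intro divide_left_mono power_mono) (auto simp: D_def)
      then show "w n * (\<integral>\<omega>. g (X n \<omega>) \<partial>M) \<le> (a n - a (Suc n)) + 1 / (real n + 1)\<^sup>2"
        using step[of n] by linarith
    qed
    also have "\<dots> = a 0 - a N + (\<Sum>n<N. 1 / (real n + 1)\<^sup>2)"
      by (simp only: sum.distrib sum_lessThan_telescope')
    also have "(\<Sum>n<N. 1 / (real n + 1)\<^sup>2) \<le> (\<Sum>n. 1 / (real n + 1)\<^sup>2)"
      by (rule sum_le_suminf[OF sq]) auto
    finally show ?thesis using a01(2)[of 0] a01(1)[of N] by (simp add: B'_def)
  qed
  let ?u = "\<lambda>n \<omega>. ennreal (w n * g (X n \<omega>))"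
  have meas: "?u n \<in> borel_measurable M" for n
    using int_g[of n] by measurable
  have nn: "(\<integral>\<^sup>+\<omega>. ?u n \<omega> \<partial>M) = ennreal (w n * (\<integral>\<omega>. g (X n \<omega>) \<partial>M))" for n
    using int_g[of n] w0 g0[OF occupation_in_prob_pairs] by (subst nn_integral_eq_integral) auto
  have "(\<integral>\<^sup>+\<omega>. (\<Sum>n. ?u n \<omega>) \<partial>M) = (\<Sum>n. \<integral>\<^sup>+\<omega>. ?u n \<omega> \<partial>M)"
    by (rule nn_integral_suminf[OF meas])
  also have "\<dots> \<le> ennreal B'"
  proof (rule suminf_le_const)
    show "summable (\<lambda>n. \<integral>\<^sup>+\<omega>. ?u n \<omega> \<partial>M)" by simp
    fix N
    have "(\<Sum>n<N. \<integral>\<^sup>+\<omega>. ?u n \<omega> \<partial>M) = ennreal (\<Sum>n<N. w n * (\<integral>\<omega>. g (X n \<omega>) \<partial>M))"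
      unfolding nn using w0 g0[OF occupation_in_prob_pairs] by (intro sum_ennreal mult_nonneg_nonneg Bochner_Integration.integral_nonneg) auto
    then show "(\<Sum>n<N. \<integral>\<^sup>+\<omega>. ?u n \<omega> \<partial>M) \<le> ennreal B'" using partial[of N] by (simp add: ennreal_leI)
  qed
  finally have "(\<integral>\<^sup>+\<omega>. (\<Sum>n. ?u n \<omega>) \<partial>M) \<noteq> \<infinity>" by (auto simp: top_unique)
  then have "AE \<omega> in M. (\<Sum>n. ?u n \<omega>) \<noteq> \<infinity>"
    by (intro nn_integral_noteq_infinite borel_measurable_suminf_order meas)
  then show ?thesis
  proof eventually_elim
    case (elim \<omega>)
    have "summable (\<lambda>n. w n * g (X n \<omega>))"
      using elim w0 g0[OF occupation_in_prob_pairs] by (intro summable_suminf_not_top) auto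
    then show ?case by (simp add: w_def g_def D_def)
  qed
qed

text \<open>Steps decay like 1 / n, so the natural clock is log n: while n grows by a factor 1 +
  \<rho>, the path moves by at most 4 \<rho>.\<close>

lemma occupation_dist_le:
  assumes "n \<le> m"
  shows "dist (X m \<omega>) (X n \<omega>) \<le> 4 * (real m - real n) / (real n + 1)"
  using assms
proof (induction m rule: dec_induct)
  case base
  show ?case by simp
next
  case (step m)
  have "dist (X (Suc m) \<omega>) (X m \<omega>) \<le> 4 / (real CARD('v) + real m + 1)"
    unfolding occupation_Suc by (rule dist_move_le[OF occupation_in_prob_pairs]) simp
  also have "\<dots> \<le> 4 / (real n + 1)"
    using step by (intro divide_left_mono) auto
  finally have "dist (X (Suc m) \<omega>) (X n \<omega>) \<le> 4 / (real n + 1) + 4 * (real m - real n) / (real n + 1)"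
    using step.IH dist_triangle[of "X (Suc m) \<omega>" "X n \<omega>" "X m \<omega>"] by linarith
  also have "\<dots> = 4 * (real (Suc m) - real n) / (real n + 1)"
    by (simp add: add_divide_distrib[symmetric])
  finally show ?case .
qed

lemma AE_gap_tendsto_0: "AE \<omega> in M. (\<lambda>n. gap 1 (X n \<omega>) + gap 2 (X n \<omega>)) \<longlonglongrightarrow> 0"
  using AE_summable_gap
proof eventually_elim
  case (elim \<omega>)
  define \<kappa> where "\<kappa> = real CARD('v)"
  have "CARD('v) > 0" by simp
  then have \<kappa>: "\<kappa> \<ge> 1" unfolding \<kappa>_def by linarith
  show ?case
  proof (rule tendsto_0_if_weighted_summable[OF _ _ _ elim])
    show "0 \<le> gap 1 (X n \<omega>) + gap 2 (X n \<omega>)" for n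
      by (intro add_nonneg_nonneg gap_nonneg occupation_in_prob_pairs)
    show "1 / (4 * \<kappa>) > 0" using \<kappa> by simp
    show "1 / (4 * \<kappa>) / (real n + 1) \<le> (real CARD('v) + real n) / (real CARD('v) + real n + 1)\<^sup>2" for n
    proof -
      define D where "D = \<kappa> + real n"
      have D: "D \<ge> 1" using \<kappa> by (simp add: D_def)
      have "(D + 1)\<^sup>2 \<le> (2 * D)\<^sup>2" using D by (intro power_mono) auto
      also have "\<dots> = D * (4 * D)" by (simp add: power2_eq_square)
      also have "4 * D \<le> 4 * \<kappa> * (real n + 1)"
        using \<kappa> mult_right_mono[of 1 \<kappa> "real n"] by (simp add: D_def algebra_simps)
      finally have "(D + 1)\<^sup>2 \<le> D * (4 * \<kappa> * (real n + 1))" using D by simp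
      then show ?thesis unfolding \<kappa>_def[symmetric] D_def[symmetric] using \<kappa> D
        by (simp add: divide_simps)
    qed
    fix \<epsilon> :: real assume "\<epsilon> > 0"
    have "continuous_on prob_pairs (\<lambda>x :: real ^ 'v ^ 2. gap 1 x + gap 2 x)"
      by (intro continuous_intros continuous_on_gap)
    then have "uniformly_continuous_on prob_pairs (\<lambda>x :: real ^ 'v ^ 2. gap 1 x + gap 2 x)"
      by (rule compact_uniformly_continuous[OF _ compact_prob_pairs])
    then obtain s where s: "s > 0" "\<And>x y :: real ^ 'v ^ 2. x \<in> prob_pairs \<Longrightarrow> y \<in> prob_pairs \<Longrightarrow> dist y x < s \<Longrightarrow>
        dist (gap 1 y + gap 2 y) (gap 1 x + gap 2 x) < \<epsilon>"
      unfolding uniformly_continuous_on_def using \<open>\<epsilon> > 0\<close> by metis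
    show "\<exists>\<rho>>0. \<forall>n m. n \<le> m \<longrightarrow> real m - real n \<le> \<rho> * real n \<longrightarrow>
        gap 1 (X n \<omega>) + gap 2 (X n \<omega>) - \<epsilon> \<le> gap 1 (X m \<omega>) + gap 2 (X m \<omega>)"
    \<comment> \<open>A relative time increase of s / 8 moves the path by at most s / 2, strictly
      below the modulus \<open>s\<close>.\<close>
    proof (intro exI[of _ "s / 8"] conjI allI impI)
      show "s / 8 > 0" using s by simp
      fix n m :: nat assume nm: "n \<le> m" "real m - real n \<le> s / 8 * real n"
      have "dist (X m \<omega>) (X n \<omega>) \<le> 4 * (real m - real n) / (real n + 1)"
        by (rule occupation_dist_le[OF nm(1)])
      also have "\<dots> \<le> 4 * (s / 8 * real n) / (real n + 1)"
        using nm by (intro divide_right_mono) auto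
      also have "\<dots> = s / 2 * (real n / (real n + 1))" by simp
      also have "\<dots> \<le> s / 2" using s by (intro mult_left_le) auto
      finally have "dist (X m \<omega>) (X n \<omega>) < s" using s by simp
      then have "dist (gap 1 (X m \<omega>) + gap 2 (X m \<omega>)) (gap 1 (X n \<omega>) + gap 2 (X n \<omega>)) < \<epsilon>"
        by (intro s occupation_in_prob_pairs)
      then show "gap 1 (X n \<omega>) + gap 2 (X n \<omega>) - \<epsilon> \<le> gap 1 (X m \<omega>) + gap 2 (X m \<omega>)"
        by (simp add: dist_real_def)
    qed
  qed
qed

end

section \<open>Limit points\<close>

lemma limit_set_iff:
  fixes X :: "nat \<Rightarrow> 'b::metric_space"
  shows "x \<in> limit_set X \<longleftrightarrow> (\<forall>n. \<forall>e>0. \<exists>k\<ge>n. dist (X k) x < e)"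
  by (auto simp: limit_set_def closure_approachable)

lemma limit_set_subset_closed:
  assumes "closed S" "\<And>n. X n \<in> S" shows "limit_set X \<subseteq> S"
proof -
  have "closure (\<Union>k\<in>{0..}. {X k}) \<subseteq> S" using assms by (intro closure_minimal) auto
  moreover have "limit_set X \<subseteq> closure (\<Union>k\<in>{0..}. {X k})"
    unfolding limit_set_def by (rule INT_lower) simp
  ultimately show ?thesis by (rule subset_trans[rotated])
qed

lemma limit_set_tendsto:
  fixes X :: "nat \<Rightarrow> 'b::metric_space" and g :: "'b \<Rightarrow> real"
  assumes x: "x \<in> limit_set X" and S: "x \<in> S" "\<And>n. X n \<in> S" and g: "continuous_on S g"
    and lim: "(\<lambda>n. g (X n)) \<longlonglongrightarrow> l"
  shows "g x = l"
proof (rule ccontr)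
  assume "g x \<noteq> l"
  then have e: "dist (g x) l / 2 > 0" by simp
  obtain r where r: "r > 0" "\<And>y. y \<in> S \<Longrightarrow> dist y x < r \<Longrightarrow> \<bar>g y - g x\<bar> < dist (g x) l / 2"
    using continuous_on_near[OF g S(1) e] by blast
  obtain N where N: "\<And>n. n \<ge> N \<Longrightarrow> dist (g (X n)) l < dist (g x) l / 2"
    using lim e unfolding lim_sequentially by blast
  obtain k where "k \<ge> N" "dist (X k) x < r" using x r(1) unfolding limit_set_iff by blast
  then have "\<bar>g (X k) - l\<bar> < \<bar>g x - l\<bar> / 2" "\<bar>g (X k) - g x\<bar> < \<bar>g x - l\<bar> / 2"
    using N[of k] r(2)[OF S(2), of k] unfolding dist_real_def by blast+
  then show False using abs_triangle_ineq4[of "g (X k) - l" "g (X k) - g x"] by simp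
qed

lemma disjoint_supp_pairs_iff: "x \<in> disjoint_supp_pairs \<longleftrightarrow> x \<in> prob_pairs \<and> overlap x = 0"
proof -
  have "overlap x = 0 \<longleftrightarrow> supp (x $ 1) \<inter> supp (x $ 2) = {}" if "x \<in> prob_pairs"
  proof -
    have "overlap x = 0 \<longleftrightarrow> (\<forall>v. x $ 1 $ v * x $ 2 $ v = 0)"
      unfolding overlap_def using that by (subst sum_nonneg_eq_0_iff) (auto simp: prob_pairs_nonneg)
    also have "\<dots> \<longleftrightarrow> supp (x $ 1) \<inter> supp (x $ 2) = {}"
      using prob_pairs_nonneg[OF that] by (auto simp: supp_def set_eq_iff less_le)
    finally show ?thesis .
  qed
  then show ?thesis by (auto simp: disjoint_supp_pairs_def)
qed

lemma continuous_on_overlap: "continuous_on S overlap"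
  unfolding overlap_def by (intro continuous_intros)

text \<open>Convergence of the overlap is a visibly measurable condition, unlike the inclusion of
  the limit set. For the direction from inclusion to convergence, compactness turns a subsequence
  with overlap bounded away from 0 into a limit point with positive overlap.\<close>

lemma limit_set_disjoint_iff:
  assumes X: "\<And>n. X n \<in> (prob_pairs :: (real ^ 'v::finite ^ 2) set)"
  shows "limit_set X \<subseteq> disjoint_supp_pairs \<longleftrightarrow> (\<lambda>n. overlap (X n)) \<longlonglongrightarrow> 0"
proof
  assume lim: "(\<lambda>n. overlap (X n)) \<longlonglongrightarrow> 0"
  show "limit_set X \<subseteq> disjoint_supp_pairs"
  proof
    fix x assume x: "x \<in> limit_set X"
    have "x \<in> prob_pairs"
      using x limit_set_subset_closed[of prob_pairs X, OF compact_imp_closed[OF compact_prob_pairs] X] by blast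
    moreover from this have "overlap x = 0" by (rule limit_set_tendsto[OF x _ X continuous_on_overlap lim])
    ultimately show "x \<in> disjoint_supp_pairs" by (simp add: disjoint_supp_pairs_iff)
  qed
next
  assume sub: "limit_set X \<subseteq> disjoint_supp_pairs"
  show "(\<lambda>n. overlap (X n)) \<longlonglongrightarrow> 0"
  proof (rule ccontr)
    assume "\<not> (\<lambda>n. overlap (X n)) \<longlonglongrightarrow> 0"
    then obtain e where e: "e > 0" "\<And>N. \<exists>n\<ge>N. \<bar>overlap (X n)\<bar> \<ge> e"
      unfolding lim_sequentially by (auto simp: not_less)
    then have "infinite {n. \<bar>overlap (X n)\<bar> \<ge> e}" by (auto simp: infinite_nat_iff_unbounded_le)
    then obtain f where f: "strict_mono f" "\<And>n :: nat. f n \<in> {n. \<bar>overlap (X n)\<bar> \<ge> e}"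
      using infinite_enumerate by blast
    obtain x g where x: "x \<in> prob_pairs" and g: "strict_mono g" "(\<lambda>n. X (f (g n))) \<longlonglongrightarrow> x"
      by (rule seq_compactE[of prob_pairs "\<lambda>n. X (f n)"])
        (auto simp: X comp_def intro: compact_imp_seq_compact compact_prob_pairs)
    have "x \<in> limit_set X"
      unfolding limit_set_iff
    proof (intro allI impI)
      fix n and e :: real assume "e > 0"
      then obtain N where N: "\<And>k. k \<ge> N \<Longrightarrow> dist (X (f (g k))) x < e" using g(2) unfolding lim_sequentially by blast
      have "f (g (max n N)) \<ge> n"
        using seq_suble[OF f(1), of "g (max n N)"] seq_suble[OF g(1), of "max n N"] by linarith
      then show "\<exists>k\<ge>n. dist (X k) x < e" using N[of "max n N"] by auto
    qed
    then have "overlap x = 0" using sub by (auto simp: disjoint_supp_pairs_iff)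
    moreover have "(\<lambda>n. overlap (X (f (g n)))) \<longlonglongrightarrow> overlap x"
      using continuous_on_overlap[of UNIV] g(2)
      by (intro isCont_tendsto_compose[of x overlap]) (auto simp: continuous_on_eq_continuous_at)
    ultimately have "(\<lambda>n. \<bar>overlap (X (f (g n)))\<bar>) \<longlonglongrightarrow> 0" by (simp add: tendsto_rabs_zero)
    moreover have "\<bar>overlap (X (f (g n)))\<bar> \<ge> e" for n using f(2)[of "g n"] by simp
    ultimately have "e \<le> 0" by (intro LIMSEQ_le_const) auto
    with e(1) show False by simp
  qed
qed

section \<open>Escape from the uniform equilibria\<close>

definition discrepancy :: "real ^ 'v::finite ^ 2 \<Rightarrow> real" where
  "discrepancy x = (\<Sum>v\<in>UNIV. (x $ 1 $ v - x $ 2 $ v)\<^sup>2)"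

lemma discrepancy_nonneg: "0 \<le> discrepancy x"
  by (simp add: discrepancy_def sum_nonneg)

lemma discrepancy_le_2:
  assumes x: "x \<in> prob_pairs" shows "discrepancy x \<le> 2"
proof -
  have "discrepancy x \<le> (\<Sum>v\<in>UNIV. x $ 1 $ v + x $ 2 $ v)"
    unfolding discrepancy_def
  proof (rule sum_mono)
    fix v
    have "\<bar>x $ 1 $ v - x $ 2 $ v\<bar> \<le> 1" "\<bar>x $ 1 $ v - x $ 2 $ v\<bar> \<le> x $ 1 $ v + x $ 2 $ v"
      using prob_pairs_nonneg[OF x, of 1 v] prob_pairs_nonneg[OF x, of 2 v]
        prob_pairs_le_1[OF x, of 1 v] prob_pairs_le_1[OF x, of 2 v] by linarith+
    then have "\<bar>x $ 1 $ v - x $ 2 $ v\<bar> * \<bar>x $ 1 $ v - x $ 2 $ v\<bar> \<le> 1 * (x $ 1 $ v + x $ 2 $ v)"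
      by (intro mult_mono) auto
    then show "(x $ 1 $ v - x $ 2 $ v)\<^sup>2 \<le> x $ 1 $ v + x $ 2 $ v"
      by (simp add: power2_eq_square)
  qed
  then show ?thesis using prob_pairs_sum[OF x] by (simp add: sum.distrib)
qed

text \<open>The last term is |e_v - e_w|^2. It separates even coinciding occupation vectors and is
  the source of the 1 / n^2 part of the drift.\<close>

lemma discrepancy_move:
  fixes x :: "real ^ 'v::finite ^ 2"
  assumes "D \<ge> 0"
  defines "u \<equiv> \<lambda>t. x $ 1 $ t - x $ 2 $ t"
  shows "discrepancy (move D x v w) =
    (D\<^sup>2 * discrepancy x + 2 * D * (u v - u w) + 2 * (1 - of_bool (v = w))) / (D + 1)\<^sup>2"
proof -
  have eq: "(move D x v w $ 1 $ t - move D x v w $ 2 $ t)\<^sup>2 =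
      (D\<^sup>2 * (u t)\<^sup>2 + 2 * D * ((if t = v then u t else 0) - (if t = w then u t else 0))
        + ((if t = v then 1 - of_bool (v = w) else 0) + (if t = w then 1 - of_bool (v = w) else 0))) / (D + 1)\<^sup>2" for t
  proof -
    have "move D x v w $ 1 $ t - move D x v w $ 2 $ t = (D * u t + (of_bool (v = t) - of_bool (w = t))) / (D + 1)"
      by (simp add: u_def diff_divide_distrib add_divide_distrib right_diff_distrib)
    then have "(move D x v w $ 1 $ t - move D x v w $ 2 $ t)\<^sup>2 =
        (D * u t + (of_bool (v = t) - of_bool (w = t)))\<^sup>2 / (D + 1)\<^sup>2" by (simp add: power_divide)
    also have "(D * u t + (of_bool (v = t) - of_bool (w = t)))\<^sup>2 =
        D\<^sup>2 * (u t)\<^sup>2 + 2 * D * ((if t = v then u t else 0) - (if t = w then u t else 0))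
        + ((if t = v then 1 - of_bool (v = w) else 0) + (if t = w then 1 - of_bool (v = w) else 0))"
      by (auto simp: power2_eq_square algebra_simps)
    finally show ?thesis .
  qed
  show ?thesis
    unfolding discrepancy_def eq
    by (simp add: u_def sum_divide_distrib[symmetric] sum.distrib sum_subtractf sum_distrib_left[symmetric])
qed

context repelling_walks
begin

lemma AE_not_tendsto_uniform_proper:
  assumes S: "S \<noteq> {}" and w: "w \<notin> (S :: 'v set)"
  shows "AE \<omega> in M. \<not> (\<lambda>n. X n \<omega>) \<longlonglongrightarrow> uniform_pair S"
proof -
  obtain c r where c: "c > 0" "r > 0"
    and rep: "\<And>x. x \<in> prob_pairs \<Longrightarrow> dist x (uniform_pair S) < r \<Longrightarrow> (1 + c) * x $ 1 $ w \<le> \<pi> 1 w x"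
    using repelled_from_proper_subset[OF S w] by metis
  define R where "R = weight 0 / weight 1"
  have R: "R \<ge> 0" using weight_pos[of 0] weight_pos[of 1] by (simp add: R_def)
  show ?thesis
  \<comment> \<open>The drift is at least c q / (4 D). Half of it stays as (c / 8) q / D, and q
    \<ge> 1 / D turns the other half into 2 b / D^2 with b = c / 16. \<open>R\<close> bounds the
    ratio of step probability to occupation; the extra 1 in \<open>C\<close> is for the
    deterministic contraction of the coordinate.\<close>
  proof (rule escape[where q = "\<lambda>x. x $ 1 $ w" and b = "c / 16" and c = "c / 8" and C = "R + 1"
        and r = r and Q = 1 and D\<^sub>0 = 3])
    fix D :: real and x :: "real ^ 'v ^ 2"
    assume D: "D \<ge> 3" and x: "x \<in> prob_pairs" and near: "dist x (uniform_pair S) < r"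
      and ge: "\<And>i v. x $ i $ v \<ge> 1 / D"
    define y where "y = x $ 1 $ w"
    have y: "0 \<le> y" "y \<le> 1" "1 / D \<le> y" unfolding y_def by (intro prob_pairs_nonneg prob_pairs_le_1 x ge)+
    have inc: "move D x v v' $ 1 $ w - y = 1 / (D + 1) * (of_bool (v = w) - y)" for v v'
      using D by (simp add: y_def field_simps)
    have sum_ob: "(\<Sum>v\<in>UNIV. \<pi> 1 v x * of_bool (v = w)) = \<pi> 1 w x" by simp
    have m1: "E x (\<lambda>v v'. move D x v v' $ 1 $ w - y) = (\<pi> 1 w x - y) / (D + 1)"
      unfolding inc step_mean_mult step_mean_diff step_mean_const[OF x] step_mean_fst[OF x] sum_ob by simp
    have "(c / 8 * y + 2 * (c / 16) / D) / D \<le> (c / 8 * y + c / 8 * y) / D"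
      using mult_left_mono[OF y(3), of "c / 8"] c D by (intro divide_right_mono add_left_mono) auto
    also have "\<dots> = c * y / (4 * D)" by simp
    also have "\<dots> \<le> c * y / (D + 1)" using c y D by (intro divide_left_mono) auto
    also have "\<dots> \<le> (\<pi> 1 w x - y) / (D + 1)"
      using rep[OF x near] D by (intro divide_right_mono) (auto simp: y_def algebra_simps)
    finally have A: "(c / 8 * y + 2 * (c / 16) / D) / D \<le> E x (\<lambda>v v'. move D x v v' $ 1 $ w - y)"
      unfolding m1 .
    have "\<pi> 1 w x \<le> R * y"
    proof -
      have "y * weight (x $ 2 $ w) / total 1 x \<le> y * weight 0 / weight 1"
        using total_ge[OF x, of 1] weight_pos[of 1] y weight_antimono[of 0 "x $ 2 $ w"] x weight_pos[of 0]
        by (intro frac_le mult_left_mono mult_nonneg_nonneg) (auto simp: prob_pairs_nonneg prob_pairs_le_1)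
      then show ?thesis by (simp add: step_prob_eq other_walk y_def R_def mult.commute)
    qed
    have sqle: "(move D x v v' $ 1 $ w - y)\<^sup>2 \<le> 1 / (D + 1)\<^sup>2 * (of_bool (v = w) + y)" for v v'
    proof -
      have "(of_bool (v = w) - y)\<^sup>2 \<le> of_bool (v = w) + y"
        using y mult_left_le[of y y] by (cases "v = w") (auto simp: power2_eq_square algebra_simps)
      then show ?thesis unfolding inc power_mult_distrib power_divide one_power2
        by (intro mult_left_mono) auto
    qed
    have "E x (\<lambda>v v'. (move D x v v' $ 1 $ w - y)\<^sup>2) \<le> E x (\<lambda>v v'. 1 / (D + 1)\<^sup>2 * (of_bool (v = w) + y))"
      by (rule step_mean_mono[OF x sqle])
    also have "\<dots> = (\<pi> 1 w x + y) / (D + 1)\<^sup>2"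
      unfolding step_mean_mult step_mean_add step_mean_const[OF x] step_mean_fst[OF x] sum_ob by simp
    also have "\<dots> \<le> (R + 1) * (y + 1 / D\<^sup>2) / D\<^sup>2"
    proof (rule frac_le)
      have "\<pi> 1 w x + y \<le> (R + 1) * y" using \<open>\<pi> 1 w x \<le> R * y\<close> by (simp add: algebra_simps)
      also have "\<dots> \<le> (R + 1) * (y + 1 / D\<^sup>2)" using R D by (intro mult_left_mono) auto
      finally show "\<pi> 1 w x + y \<le> (R + 1) * (y + 1 / D\<^sup>2)" .
    qed (use R y D in \<open>auto intro: power_mono\<close>)
    finally have B: "E x (\<lambda>v v'. (move D x v v' $ 1 $ w - y)\<^sup>2) \<le> (R + 1) * (y + 1 / D\<^sup>2) / D\<^sup>2" .
    have C: "- (y + c / 16 / D) / 4 \<le> move D x v v' $ 1 $ w - y" for v v'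
    proof -
      have "y / (D + 1) \<le> y / 4" using D y by (intro divide_left_mono) auto
      moreover have "c / 16 / D \<ge> 0" using c D by simp
      then have "- (y + c / 16 / D) / 4 \<le> - (y / 4)" unfolding minus_divide_left[symmetric] by simp
      ultimately have "- (y + c / 16 / D) / 4 \<le> - (y / (D + 1))" by linarith
      also have "\<dots> \<le> move D x v v' $ 1 $ w - y"
        unfolding inc using D y by (simp add: field_simps)
      finally show ?thesis .
    qed
    show "(c / 8 * x $ 1 $ w + 2 * (c / 16) / D) / D \<le> E x (\<lambda>v v'. move D x v v' $ 1 $ w - x $ 1 $ w) \<and>
      E x (\<lambda>v v'. (move D x v v' $ 1 $ w - x $ 1 $ w)\<^sup>2) \<le> (R + 1) * (x $ 1 $ w + 1 / D\<^sup>2) / D\<^sup>2 \<and>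
      (\<forall>v v'. - (x $ 1 $ w + c / 16 / D) / 4 \<le> move D x v v' $ 1 $ w - x $ 1 $ w)"
      using A B C unfolding y_def by blast
  next
    show "uniform_pair S $ 1 $ w = (0 :: real)" using w by (simp add: uniform_pair_def)
    show "isCont (\<lambda>x :: real ^ 'v ^ 2. x $ 1 $ w) (uniform_pair S)" by (intro continuous_intros)
  qed (use c R in \<open>auto simp: prob_pairs_nonneg prob_pairs_le_1\<close>)
qed

text \<open>A quadratic quantity is used because the noise raises its mean, whereas in a linear one
  it would average out.\<close>

lemma AE_not_tendsto_uniform:
  assumes card: "CARD('v) \<ge> 2"
  shows "AE \<omega> in M. \<not> (\<lambda>n. X n \<omega>) \<longlonglongrightarrow> uniform_pair UNIV"
proof -
  let ?p = "uniform_pair UNIV :: real ^ 'v ^ 2"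
  obtain c r\<^sub>1 where c: "c > 0" "r\<^sub>1 > 0"
    and rep: "\<And>x :: real ^ 'v ^ 2. x \<in> prob_pairs \<Longrightarrow> dist x ?p < r\<^sub>1 \<Longrightarrow>
      (1 + c) * discrepancy x \<le> (\<Sum>v\<in>UNIV. (x $ 1 $ v - x $ 2 $ v) * (\<pi> 1 v x - \<pi> 2 v x))"
    by (rule diagonal_repelled_near_uniform[folded discrepancy_def]) blast
  \<comment> \<open>The probability that both walks choose the same vertex. At the uniform pair it
    is 1 / \<kappa> \<le> 1 / 2, hence at most 3 / 4 nearby, and the noise term 2 (1 - P) is at
    least 1 / 2.\<close>
  define P where "P x = (\<Sum>v\<in>UNIV. \<pi> 1 v x * \<pi> 2 v x)" for x :: "real ^ 'v ^ 2"
  have p: "?p \<in> prob_pairs" by (rule uniform_pair_in_prob_pairs) simp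
  have "P ?p \<le> 1 / 2"
  proof -
    have "\<pi> i v ?p = 1 / real CARD('v)" for i v
      using total_pos[OF p, of i] by (simp add: step_prob_eq total_uniform_pair) (simp add: uniform_pair_def)
    then have "P ?p = 1 / real CARD('v)" by (simp add: P_def)
    also have "\<dots> \<le> 1 / 2" using card by (intro divide_left_mono) auto
    finally show ?thesis .
  qed
  moreover have "continuous_on prob_pairs P" unfolding P_def by (intro continuous_intros continuous_on_step_prob)
  then obtain r\<^sub>2 where r2: "r\<^sub>2 > 0" "\<And>x. x \<in> prob_pairs \<Longrightarrow> dist x ?p < r\<^sub>2 \<Longrightarrow> \<bar>P x - P ?p\<bar> < 1 / 4"
    using continuous_on_near[OF _ p, of P "1 / 4"] by auto
  ultimately have P34: "P x \<le> 3 / 4" if "x \<in> prob_pairs" "dist x ?p < r\<^sub>2" for x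
    using r2(2)[OF that] unfolding abs_less_iff by linarith
  show ?thesis
  \<comment> \<open>The numerator of the drift is at least 2 D c q - q + 1 / 2, hence at least D c q
    + 1 / 2 once D c \<ge> 1. Division by (D + 1)^2 \<le> 4 D^2 gives c / 4 and 2 b = 1 / 8. The
    threshold 1024 makes 16 / D^2 at most a quarter of b / D in the bound on downward steps.\<close>
  proof (rule escape[where q = discrepancy and b = "1 / 16" and c = "c / 4" and C = 64
        and r = "min r\<^sub>1 r\<^sub>2" and Q = 2 and D\<^sub>0 = "max 1024 (1 / c)"])
    fix D :: real and x :: "real ^ 'v ^ 2"
    assume "D \<ge> max 1024 (1 / c)" and x: "x \<in> prob_pairs" and near: "dist x ?p < min r\<^sub>1 r\<^sub>2"
    then have D: "D \<ge> 1024" "D \<ge> 1 / c" by auto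
    have D1: "D * c \<ge> 1" using D(2) c by (simp add: field_simps)
    define q where "q = discrepancy x"
    have q: "0 \<le> q" "q \<le> 2" by (simp_all add: q_def discrepancy_nonneg discrepancy_le_2 x)
    define u where "u t = x $ 1 $ t - x $ 2 $ t" for t
    have Dsq: "(D + 1)\<^sup>2 > 0" "D\<^sup>2 \<le> (D + 1)\<^sup>2" "(D + 1)\<^sup>2 \<le> 4 * D\<^sup>2"
      using D(1) power_mono[of "D + 1" "2 * D" 2] by (auto simp: power_mult_distrib intro: power_mono)
    have inc: "discrepancy (move D x v w) - q =
        ((- (2 * D + 1) * q + 2 * D * (u v - u w)) + 2 * (1 - of_bool (v = w))) / (D + 1)\<^sup>2" for v w
    proof -
      have "discrepancy (move D x v w) = (D\<^sup>2 * q + 2 * D * (u v - u w) + 2 * (1 - of_bool (v = w))) / (D + 1)\<^sup>2"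
        using D(1) by (simp only: discrepancy_move q_def u_def)
      moreover have "q = ((D + 1)\<^sup>2 * q) / (D + 1)\<^sup>2" using Dsq by simp
      ultimately have "discrepancy (move D x v w) - q =
          ((D\<^sup>2 * q + 2 * D * (u v - u w) + 2 * (1 - of_bool (v = w))) - (D + 1)\<^sup>2 * q) / (D + 1)\<^sup>2"
        by (simp add: diff_divide_distrib)
      then show ?thesis by (simp add: power2_eq_square algebra_simps)
    qed
    \<comment> \<open>The leading part of an increment is proportional to \<open>u v - u w\<close>,
      so this bound makes its square proportional to \<open>q\<close>.\<close>
    have uvw: "(u v - u w)\<^sup>2 \<le> 2 * q" for v w
    proof (cases "v = w")
      case False
      have "(u v)\<^sup>2 + (u w)\<^sup>2 = (\<Sum>t\<in>{v, w}. (u t)\<^sup>2)" using False by simp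
      also have "\<dots> \<le> q" unfolding q_def discrepancy_def u_def by (rule sum_mono2) auto
      finally show ?thesis using square_diff_le[of "u v" "u w"] by simp
    qed (use q in simp)
    have m1: "E x (\<lambda>v w. discrepancy (move D x v w) - q) =
        ((- (2 * D + 1) * q + 2 * D * (\<Sum>v\<in>UNIV. u v * (\<pi> 1 v x - \<pi> 2 v x))) + 2 * (1 - P x)) / (D + 1)\<^sup>2"
    proof -
      have ob: "E x (\<lambda>v w. of_bool (v = w)) = P x" by (simp add: step_mean_def P_def)
      have "E x (\<lambda>v w. discrepancy (move D x v w) - q) = E x (\<lambda>v w. 1 / (D + 1)\<^sup>2 *
          ((- (2 * D + 1) * q + 2 * D * (u v - u w)) + 2 * (1 - of_bool (v = w))))"
        unfolding inc by simp
      also have "\<dots> = 1 / (D + 1)\<^sup>2 * ((- (2 * D + 1) * q + 2 * D *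
          ((\<Sum>v\<in>UNIV. \<pi> 1 v x * u v) - (\<Sum>v\<in>UNIV. \<pi> 2 v x * u v))) + 2 * (1 - P x))"
        unfolding step_mean_mult step_mean_add step_mean_diff step_mean_const[OF x] step_mean_fst[OF x]
          step_mean_snd[OF x] ob ..
      finally show ?thesis
        by (simp add: right_diff_distrib sum_subtractf mult.commute)
    qed
    have A: "(c / 4 * q + 2 * (1 / 16) / D) / D \<le> E x (\<lambda>v w. discrepancy (move D x v w) - q)"
    proof -
      have "(c / 4 * q + 2 * (1 / 16) / D) / D = (D * c * q + 1 / 2) / (4 * D\<^sup>2)"
        using D(1) by (simp add: field_simps power2_eq_square)
      also have "\<dots> \<le> (D * c * q + 1 / 2) / (D + 1)\<^sup>2"
        using Dsq D c q by (intro divide_left_mono) auto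
      also have "\<dots> \<le> ((- (2 * D + 1) * q + 2 * D * (\<Sum>v\<in>UNIV. u v * (\<pi> 1 v x - \<pi> 2 v x))) + 2 * (1 - P x)) / (D + 1)\<^sup>2"
      proof (rule divide_right_mono)
        have "2 * D * ((1 + c) * q) \<le> 2 * D * (\<Sum>v\<in>UNIV. u v * (\<pi> 1 v x - \<pi> 2 v x))"
          using rep[OF x] near D(1) unfolding q_def u_def by (intro mult_left_mono) auto
        moreover have "1 * q \<le> D * c * q" using D1 q by (intro mult_right_mono) auto
        moreover have "P x \<le> 3 / 4" using P34[OF x] near by simp
        ultimately show "D * c * q + 1 / 2 \<le> (- (2 * D + 1) * q + 2 * D * (\<Sum>v\<in>UNIV. u v * (\<pi> 1 v x - \<pi> 2 v x))) + 2 * (1 - P x)"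
          by (simp add: algebra_simps)
      qed simp
      finally show ?thesis unfolding m1 .
    qed
    have sqle: "(discrepancy (move D x v w) - q)\<^sup>2 \<le> 64 * (q + 1 / D\<^sup>2) / D\<^sup>2" for v w
    proof -
      define d where "d = (1 - of_bool (v = w) :: real)"
      have d: "0 \<le> d" "d \<le> 1" by (auto simp: d_def)
      have "(- (2 * D + 1) * q + 2 * D * (u v - u w) + 2 * d)\<^sup>2
          \<le> 2 * (- (2 * D + 1) * q + 2 * D * (u v - u w))\<^sup>2 + 2 * (- 2 * d)\<^sup>2"
        using square_diff_le[of "- (2 * D + 1) * q + 2 * D * (u v - u w)" "- 2 * d"] by simp
      also have "(- (2 * D + 1) * q + 2 * D * (u v - u w))\<^sup>2 \<le> 2 * ((2 * D + 1) * q)\<^sup>2 + 2 * (2 * D * (u v - u w))\<^sup>2"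
      proof -
        have "- (2 * D + 1) * q + 2 * D * (u v - u w) = 2 * D * (u v - u w) - (2 * D + 1) * q"
          by (simp add: algebra_simps)
        then show ?thesis using square_diff_le[of "2 * D * (u v - u w)" "(2 * D + 1) * q"] by (simp only: add.commute)
      qed
      also have "((2 * D + 1) * q)\<^sup>2 \<le> 8 * (D + 1)\<^sup>2 * q"
      proof -
        have "((2 * D + 1) * q)\<^sup>2 \<le> (2 * (D + 1))\<^sup>2 * (q * q)"
          unfolding power_mult_distrib[of _ q] power2_eq_square[of q]
          using D q by (intro mult_right_mono power_mono) auto
        also have "\<dots> \<le> (2 * (D + 1))\<^sup>2 * (2 * q)" using q by (intro mult_left_mono mult_right_mono) auto
        also have "\<dots> = 8 * (D + 1)\<^sup>2 * q" by (simp only: power_mult_distrib) simp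
        finally show ?thesis .
      qed
      also have "(2 * D * (u v - u w))\<^sup>2 \<le> 8 * (D + 1)\<^sup>2 * q"
      proof -
        have "(2 * D * (u v - u w))\<^sup>2 = 4 * D\<^sup>2 * (u v - u w)\<^sup>2" by (simp add: power_mult_distrib)
        also have "\<dots> \<le> 4 * (D + 1)\<^sup>2 * (2 * q)" using Dsq uvw q by (intro mult_mono) auto
        finally show ?thesis by simp
      qed
      also have "(- 2 * d)\<^sup>2 \<le> 4" using d power_le_one[of d 2] by (simp add: power_mult_distrib)
      finally have "(- (2 * D + 1) * q + 2 * D * (u v - u w) + 2 * d)\<^sup>2 \<le> 64 * ((D + 1)\<^sup>2 * q) + 8" by (simp only:) (simp add: mult_ac)
      then have "((- (2 * D + 1) * q + 2 * D * (u v - u w) + 2 * d) / (D + 1)\<^sup>2)\<^sup>2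
          \<le> (64 * ((D + 1)\<^sup>2 * q) + 8) / ((D + 1)\<^sup>2)\<^sup>2"
        unfolding power_divide by (intro divide_right_mono) auto
      then have "(discrepancy (move D x v w) - q)\<^sup>2 \<le> (64 * ((D + 1)\<^sup>2 * q) + 8) / ((D + 1)\<^sup>2)\<^sup>2"
        unfolding inc d_def .
      also have "\<dots> = 64 * q / (D + 1)\<^sup>2 + 8 / ((D + 1)\<^sup>2)\<^sup>2"
      proof -
        have "(64 * (a * q) + 8) / a\<^sup>2 = 64 * q / a + 8 / a\<^sup>2" if "a > 0" for a
          using that by (simp add: add_divide_distrib power2_eq_square)
        from this[OF Dsq(1)] show ?thesis .
      qed
      also have "\<dots> \<le> 64 * q / D\<^sup>2 + 8 / (D\<^sup>2)\<^sup>2"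
        using Dsq D q by (intro add_mono divide_left_mono power_mono) auto
      also have "\<dots> \<le> 64 * q / D\<^sup>2 + 64 / (D\<^sup>2)\<^sup>2"
        by (intro add_left_mono divide_right_mono) auto
      also have "\<dots> = 64 * (q + 1 / D\<^sup>2) / D\<^sup>2"
        by (simp add: add_divide_distrib power2_eq_square[of "D\<^sup>2"])
      finally show ?thesis .
    qed
    have B: "E x (\<lambda>v w. (discrepancy (move D x v w) - q)\<^sup>2) \<le> 64 * (q + 1 / D\<^sup>2) / D\<^sup>2"
      using step_mean_mono[OF x sqle] unfolding step_mean_const[OF x] .
    have C: "- (q + 1 / 16 / D) / 4 \<le> discrepancy (move D x v w) - q" for v w
    proof -
      define z where "z = \<bar>u v - u w\<bar>"
      have z: "z\<^sup>2 \<le> 2 * q" using uvw[of v w] by (simp add: z_def)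
      \<comment> \<open>A downward step has size about 2 z / D with \<open>z\<close> of order sqrt
        q, which is not small compared with \<open>q\<close> near 0. Completing the square splits it
        into q / 8 and a part of order 1 / D^2 that the shift b / D absorbs.\<close>
      have "0 \<le> (z / 4 - 4 / D)\<^sup>2" by simp
      also have "\<dots> = z\<^sup>2 / 16 - 2 * z / D + 16 / D\<^sup>2" by (simp add: power2_diff power_divide)
      finally have "2 * z / D \<le> q / 8 + 16 / D\<^sup>2" using z by linarith
      moreover have "16 / D\<^sup>2 \<le> 1 / 16 / D / 4"
        using D by (simp add: field_simps power2_eq_square)
      moreover have "2 * q / D \<le> q / 8" using D q mult_right_mono[of 16 D q] by (simp add: field_simps)
      ultimately have "- (q + 1 / 16 / D) / 4 \<le> - (2 * q / D) - 2 * z / D"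
        unfolding minus_divide_left[symmetric] add_divide_distrib by linarith
      also have "\<dots> = - ((2 * D * q + 2 * D * z) / D\<^sup>2)"
        using D by (simp add: add_divide_distrib power2_eq_square)
      also have "\<dots> \<le> - (((2 * D + 1) * q + 2 * D * z) / (D + 1)\<^sup>2)"
      proof -
        have "(2 * D + 1) * q / (D + 1)\<^sup>2 \<le> 2 * D * q / D\<^sup>2"
        proof -
          have "(2 * D + 1) * D \<le> 2 * (D + 1)\<^sup>2" using D by (simp add: power2_eq_square algebra_simps)
          then have "((2 * D + 1) * D) * q \<le> (2 * (D + 1)\<^sup>2) * q" by (rule mult_right_mono[OF _ q(1)])
          then have "(2 * D + 1) * q / (D + 1)\<^sup>2 \<le> 2 * q / D"
            using D Dsq by (simp add: divide_simps) (simp add: mult_ac)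
          then show ?thesis using D by (simp add: power2_eq_square)
        qed
        moreover have "2 * D * z / (D + 1)\<^sup>2 \<le> 2 * D * z / D\<^sup>2"
          using D Dsq by (intro divide_left_mono) (auto simp: z_def)
        ultimately show ?thesis by (simp add: add_divide_distrib)
      qed
      also have "\<dots> \<le> discrepancy (move D x v w) - q"
      proof -
        have "2 * D * - z \<le> 2 * D * (u v - u w)" using D by (intro mult_left_mono) (auto simp: z_def)
        then have "- ((2 * D + 1) * q + 2 * D * z) \<le> - (2 * D + 1) * q + 2 * D * (u v - u w) + 2 * (1 - of_bool (v = w))"
          by (auto simp: algebra_simps)
        from divide_right_mono[OF this, of "(D + 1)\<^sup>2"] show ?thesis
          unfolding inc minus_divide_left by (simp only: zero_le_power2)
      qed
      finally show ?thesis .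
    qed
    show "(c / 4 * discrepancy x + 2 * (1 / 16) / D) / D \<le> E x (\<lambda>v w. discrepancy (move D x v w) - discrepancy x) \<and>
      E x (\<lambda>v w. (discrepancy (move D x v w) - discrepancy x)\<^sup>2) \<le> 64 * (discrepancy x + 1 / D\<^sup>2) / D\<^sup>2 \<and>
      (\<forall>v w. - (discrepancy x + 1 / 16 / D) / 4 \<le> discrepancy (move D x v w) - discrepancy x)"
      using A B C unfolding q_def by blast
  next
    show "discrepancy ?p = 0" by (simp add: discrepancy_def uniform_pair_def)
    show "isCont discrepancy ?p" unfolding discrepancy_def by (intro continuous_intros)
  qed (use c r2 in \<open>auto simp: discrepancy_nonneg discrepancy_le_2\<close>)
qed

text \<open>The other uniform pairs are finitely many, hence at positive distance. Disjointly
  supported pairs have overlap 0, whereas the overlap is positive at \<open>p\<close> and, by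
  continuity, near it.\<close>

lemma isolated_gap_zero:
  assumes p: "p = uniform_pair S" "S \<noteq> {}"
  obtains R where "R > 0"
    "\<And>x :: real ^ 'v ^ 2. x \<in> prob_pairs \<Longrightarrow> dist x p < R \<Longrightarrow> gap 1 x + gap 2 x = 0 \<Longrightarrow> x = p"
proof -
  obtain d where d: "d > 0" "\<And>x. x \<in> range uniform_pair \<Longrightarrow> x \<noteq> p \<Longrightarrow> d \<le> dist p x"
    using finite_set_avoid[of "range (uniform_pair :: 'v set \<Rightarrow> _)" p] by auto
  have pp: "p \<in> prob_pairs" using p by (simp add: uniform_pair_in_prob_pairs)
  have "overlap p \<noteq> 0"
  proof -
    have "card S > 0" using p by (simp add: card_gt_0_iff)
    then have "supp (p $ 1) \<inter> supp (p $ 2) = S" by (auto simp: p supp_def uniform_pair_def)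
    then show ?thesis using p pp disjoint_supp_pairs_iff[of p] by (auto simp: disjoint_supp_pairs_def)
  qed
  then have pos: "overlap p > 0" using overlap_nonneg[OF pp] by simp
  obtain r where r: "r > 0" "\<And>x. x \<in> prob_pairs \<Longrightarrow> dist x p < r \<Longrightarrow> \<bar>overlap x - overlap p\<bar> < overlap p"
    using continuous_on_near[OF continuous_on_overlap pp pos] by blast
  show thesis
  proof (rule that[of "min d r"])
    show "min d r > 0" using d r by simp
    fix x :: "real ^ 'v ^ 2"
    assume x: "x \<in> prob_pairs" "dist x p < min d r" "gap 1 x + gap 2 x = 0"
    have "overlap x \<noteq> 0" using r(2)[OF x(1)] x(2) pos by auto
    then have "x \<in> range uniform_pair" using gap_zero_cases[OF x(1,3)] by (auto simp: disjoint_supp_pairs_iff)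
    then show "x = p" using d(2)[of x] x(2) by (auto simp: dist_commute)
  qed
qed

text \<open>The step sizes tend to zero, so the path cannot jump across an annulus around \<open>p\<close> on which the
  gap is bounded below.\<close>

lemma tendsto_isolated_limit_point:
  assumes gap: "(\<lambda>n. gap 1 (X n \<omega>) + gap 2 (X n \<omega>)) \<longlonglongrightarrow> 0"
    and p: "p \<in> limit_set (\<lambda>n. X n \<omega>)" "p = uniform_pair S" "S \<noteq> {}"
  shows "(\<lambda>n. X n \<omega>) \<longlonglongrightarrow> p"
proof -
  let ?g = "\<lambda>x :: real ^ 'v ^ 2. gap 1 x + gap 2 x"
  obtain R where R: "R > 0" "\<And>x. x \<in> prob_pairs \<Longrightarrow> dist x p < R \<Longrightarrow> ?g x = 0 \<Longrightarrow> x = p"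
    using isolated_gap_zero[OF p(2,3)] by blast
  show ?thesis
    unfolding lim_sequentially
  proof (intro allI impI)
    fix e :: real assume "e > 0"
    \<comment> \<open>The annulus between the radii \<open>r\<close> and \<open>2 * r\<close> lies
      inside the ball of radius \<open>R\<close>, so it contains no zero of the gap.\<close>
    define r where "r = min e R / 3"
    have r: "r > 0" "r < e" "2 * r < R" using \<open>e > 0\<close> R(1) by (auto simp: r_def min_def field_simps)
    define A where "A = prob_pairs \<inter> {x. r \<le> dist x p \<and> dist x p \<le> 2 * r}"
    have "closed {x. r \<le> dist x p \<and> dist x p \<le> 2 * r}"
      by (intro closed_Collect_conj closed_Collect_le continuous_intros)
    then have A: "compact A" unfolding A_def by (intro compact_Int_closed compact_prob_pairs)
    have "\<exists>\<mu>>0. \<forall>x\<in>A. \<mu> \<le> ?g x"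
    proof (cases "A = {}")
      case True
      then show ?thesis by (intro exI[of _ 1]) simp
    next
      case False
      have "continuous_on A ?g"
        by (rule continuous_on_subset[of prob_pairs]) (auto intro!: continuous_intros continuous_on_gap simp: A_def)
      then obtain z where z: "z \<in> A" "\<And>x. x \<in> A \<Longrightarrow> ?g z \<le> ?g x"
        using continuous_attains_inf[OF A False] by blast
      have "?g z \<noteq> 0" using R(2)[of z] z(1) r by (auto simp: A_def)
      moreover have "?g z \<ge> 0" using z(1) by (auto simp: A_def intro: add_nonneg_nonneg gap_nonneg)
      ultimately show ?thesis using z(2) by (intro exI[of _ "?g z"]) auto
    qed
    then obtain \<mu> where \<mu>: "\<mu> > 0" "\<And>x. x \<in> A \<Longrightarrow> \<mu> \<le> ?g x" by blast
    obtain N where N: "\<And>n. n \<ge> N \<Longrightarrow> ?g (X n \<omega>) < \<mu>"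
      using order_tendstoD(2)[OF gap \<mu>(1)] unfolding eventually_sequentially by blast
    \<comment> \<open>Past this time a single step is shorter than \<open>r\<close>, the width of
      the annulus.\<close>
    obtain N' :: nat where N': "real N' > 4 / r" using reals_Archimedean2 by blast
    obtain k where k: "k \<ge> max N N'" "dist (X k \<omega>) p < r"
      using p(1) r(1) unfolding limit_set_iff by blast
    have "dist (X n \<omega>) p < r" if "n \<ge> k" for n
      using that
    proof (induction n rule: dec_induct)
      case base
      show ?case by (rule k(2))
    next
      case (step n)
      have "dist (X (Suc n) \<omega>) (X n \<omega>) \<le> 4 / (real n + 1)"
        using occupation_dist_le[of n "Suc n" \<omega>] by simp
      also have "4 / r < real n + 1" using N' k(1) step(1) by linarith
      then have "4 / (real n + 1) < r" using r(1) by (simp add: field_simps)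
      finally have "dist (X (Suc n) \<omega>) p < 2 * r"
        using step.IH dist_triangle[of "X (Suc n) \<omega>" p "X n \<omega>"] by linarith
      moreover have "X (Suc n) \<omega> \<notin> A" using \<mu>(2)[of "X (Suc n) \<omega>"] N[of "Suc n"] k(1) step(1) by fastforce
      ultimately show ?case using occupation_in_prob_pairs[of "Suc n" \<omega>] by (auto simp: A_def)
    qed
    then show "\<exists>no. \<forall>n\<ge>no. dist (X n \<omega>) p < e" using r(2) by (intro exI[of _ k]) force
  qed
qed

lemma AE_limit_set_disjoint:
  assumes card: "CARD('v) \<ge> 2"
  shows "AE \<omega> in M. limit_set (\<lambda>n. X n \<omega>) \<subseteq> disjoint_supp_pairs"
proof -
  have "AE \<omega> in M. \<not> (\<lambda>n. X n \<omega>) \<longlonglongrightarrow> uniform_pair S" if "S \<noteq> {}" for S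
  proof (cases "S = UNIV")
    case True
    then show ?thesis using AE_not_tendsto_uniform[OF card] by simp
  next
    case False
    then obtain w where "w \<notin> S" by blast
    then show ?thesis by (rule AE_not_tendsto_uniform_proper[OF that])
  qed
  then have "AE \<omega> in M. \<forall>S\<in>- {{}}. \<not> (\<lambda>n. X n \<omega>) \<longlonglongrightarrow> uniform_pair S"
    by (intro AE_finite_allI) auto
  with AE_gap_tendsto_0 show ?thesis
  proof eventually_elim
    case (elim \<omega>)
    show ?case
    proof
      fix x assume x: "x \<in> limit_set (\<lambda>n. X n \<omega>)"
      have xp: "x \<in> prob_pairs"
        using x limit_set_subset_closed[of prob_pairs "\<lambda>n. X n \<omega>",
            OF compact_imp_closed[OF compact_prob_pairs] occupation_in_prob_pairs] by blast
      have "continuous_on prob_pairs (\<lambda>x :: real ^ 'v ^ 2. gap 1 x + gap 2 x)"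
        by (intro continuous_intros continuous_on_gap)
      from limit_set_tendsto[OF x xp occupation_in_prob_pairs this elim(1)]
      have "gap 1 x + gap 2 x = 0" .
      from gap_zero_cases[OF xp this] show "x \<in> disjoint_supp_pairs"
      proof
        assume "\<exists>S. S \<noteq> {} \<and> x = uniform_pair S"
        then obtain S where S: "S \<noteq> {}" "x = uniform_pair S" by blast
        have "(\<lambda>n. X n \<omega>) \<longlonglongrightarrow> x" by (rule tendsto_isolated_limit_point[OF elim(1) x S(2,1)])
        then show ?thesis using elim(2) S by blast
      qed
    qed
  qed
qed

text \<open>The measure of a nonmeasurable set is 0 by convention, so the almost sure statement must
  be supplemented by measurability of the event. It follows from rewriting the event as convergence
  of the overlap, a countable combination of measurable conditions.\<close>

lemma prob_limit_set_disjoint: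
  assumes card: "CARD('v) \<ge> 2"
  shows "\<P>(\<omega> in M. limit_set (\<lambda>n. X n \<omega>) \<subseteq> disjoint_supp_pairs) = 1"
proof -
  have "{\<omega> \<in> space M. (\<lambda>n. overlap (X n \<omega>)) \<longlonglongrightarrow> 0} \<in> sets M"
  proof -
    have "(\<lambda>n. overlap (X n \<omega>)) \<longlonglongrightarrow> 0 \<longleftrightarrow> (\<forall>k. \<exists>N. \<forall>n\<ge>N. dist (overlap (X n \<omega>)) 0 < 1 / real (Suc k))" for \<omega>
      unfolding lim_sequentially by (meson nat_approx_posE less_trans zero_less_divide_1_iff of_nat_0_less_iff zero_less_Suc)
    then show ?thesis by simp
  qed
  then show ?thesis
    using AE_limit_set_disjoint[OF card]
    by (subst prob_Collect_eq_1) (simp_all add: limit_set_disjoint_iff occupation_in_prob_pairs)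
qed

end

theorem theorem4:
  fixes M :: "'a measure"
    and \<alpha> \<eta> :: real
    and W :: "2 \<Rightarrow> nat \<Rightarrow> 'a \<Rightarrow> 'v::finite"
  assumes "CARD('v) \<ge> 2"
    and "\<alpha> > 0"
    and "\<eta> > 1"
    and "interacting_walks M \<alpha> \<eta> W"
  shows "\<P>(\<omega> in M. limit_set (\<lambda>n. occupation W n \<omega>) \<subseteq> disjoint_supp_pairs) = 1"
proof -
  interpret interacting_walks M \<alpha> \<eta> W by (rule assms(4))
  interpret repelling_walks M \<alpha> \<eta> W
    using assms(2,3) by unfold_locales
  show ?thesis by (rule prob_limit_set_disjoint[OF assms(1)])
qed

end
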